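(* Let $C_T=C_{\rm clip}/4$, where $C_{\rm clip}$ is a universal constant for the clipping inequality recalled in the context. For any unconditional log-concave random vector $X$ in $\mathbb{R}^d$, any $a_1,\dots,a_d>0$ and any $v\in\mathbb{R}^d$, put $$F(X)=\sum_{i=1}^d v_i\bigl(1-e^{-a_i|X_i|}\bigr).$$ Then $$\log\mathbb{E}e^{t(F-\mathbb{E}F)}\le C_T\,t^2\|v\|_2^2\qquad(t\in\mathbb{R}).$$ In particular, for $r>0$ and $v\ne0$, $$\mathbb{P}(|F-\mathbb{E}F|\ge r)\le 2\exp\!\left(-\frac{r^2}{4C_T\|v\|_2^2}\right).$$
   Context: A random vector $X$ in $\mathbb{R}^d$ is unconditional if $(\varepsilon_iX_i)_{i=1}^d$ has the same distribution as $X$ for every deterministic choice of signs $\varepsilon_i\in\{-1,1\}$. Log-concavity is meant in the measure sense: the law $\nu$ of $X$ satisfies $\nu(\theta A+(1-\theta)B)\ge\nu(A)^\theta\nu(B)^{1-\theta}$ for all nonempty compact $A,B$ and $\theta\in[0,1]$; laws supported on a proper subspace are allowed. Clipping inequality: put $\Delta(v)=v-1-\log v$ for $v>0$, $\Delta(0)=+\infty$, and $c_R(x)=\min(x/R,1)$ for $x\ge0$, $R>0$. $C_{\rm clip}<\infty$ is a universal constant (such a constant exists) such that for every $R>0$, every nonincreasing probability density $h$ on $\mathbb{R}_+=[0,\infty)$ and every nondecreasing locally absolutely continuous $T:\mathbb{R}_+\to\mathbb{R}_+$ with $T(0)=0$, $$\int_0^\infty|c_R(T(x))-c_R(x)|^2h(x)\,dx\le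 C_{\rm clip}\int_0^\infty\Delta(T'(x))h(x)\,dx.$$ *)

theory Defs
  imports "HOL-Probability.Probability"
begin

definition unconditional :: "'a measure \<Rightarrow> ('a \<Rightarrow> real ^ 'n) \<Rightarrow> bool" where
  "unconditional M X \<longleftrightarrow>
     (\<forall>\<epsilon> :: 'n \<Rightarrow> real. (\<forall>i. \<epsilon> i \<in> {-1, 1}) \<longrightarrow>
        distr M borel (\<lambda>\<omega>. \<chi> i. \<epsilon> i * X \<omega> $ i) = distr M borel X)"

text \<open>
  Log-concavity of a measure in the sense of Borell; no density is required. At the endpoints
  \<open>\<theta> = 0\<close> and \<open>\<theta> = 1\<close> the condition holds trivially, so the
  convention \<open>0 powr 0 = 0\<close> is harmless.
\<close>

definition log_concave_measure :: "'a :: euclidean_space measure \<Rightarrow> bool" where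
  "log_concave_measure \<nu> \<longleftrightarrow>
     (\<forall>A B. \<forall>\<theta>\<in>{0..1}. compact A \<and> A \<noteq> {} \<and> compact B \<and> B \<noteq> {} \<longrightarrow>
        measure \<nu> {\<theta> *\<^sub>R x + (1 - \<theta>) *\<^sub>R y | x y. x \<in> A \<and> y \<in> B}
          \<ge> measure \<nu> A powr \<theta> * measure \<nu> B powr (1 - \<theta>))"

definition abs_continuous_on :: "real set \<Rightarrow> (real \<Rightarrow> real) \<Rightarrow> bool" where
  "abs_continuous_on S f \<longleftrightarrow>
     (\<forall>\<epsilon>>0. \<exists>\<delta>>0. \<forall>(n :: nat) (u :: nat \<Rightarrow> real) w.
        (\<forall>i<n. u i \<le> w i \<and> {u i..w i} \<subseteq> S) \<and>
        disjoint_family_on (\<lambda>i. {u i<..<w i}) {..<n} \<and>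
        (\<Sum>i<n. w i - u i) < \<delta> \<longrightarrow>
        (\<Sum>i<n. \<bar>f (w i) - f (u i)\<bar>) < \<epsilon>)"

definition clip :: "real \<Rightarrow> real \<Rightarrow> real" where
  "clip R x = min (x / R) 1"

text \<open>
  Only arguments \<open>v \<ge> 0\<close> matter: below, \<open>\<Delta>\<close> is applied to the
  derivative of a nondecreasing function.
\<close>

definition Delta :: "real \<Rightarrow> ennreal" where
  "Delta v = (if v > 0 then ennreal (v - 1 - ln v) else \<infinity>)"

text \<open>
  \<open>C\<close> is an admissible constant in the clipping inequality. Functions on
  \<open>[0, \<infinity>)\<close> are functions on the reals whose values on the negative
  half-line are irrelevant. Both sides may be infinite. Since \<open>T\<close> is differentiable at
  almost every \<open>x > 0\<close>, the value of \<open>deriv T\<close> elsewhere does not matter.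
  Positivity of \<open>C\<close> is no restriction, as the left-hand side can be positive while the
  integral on the right is finite; it is stated because \<open>ennreal C\<close> truncates negative
  reals and \<open>0 * \<infinity> = 0\<close>.
\<close>

definition clipping_constant :: "real \<Rightarrow> bool" where
  "clipping_constant C \<longleftrightarrow> 0 < C \<and>
     (\<forall>(R :: real) (h :: real \<Rightarrow> real) (T :: real \<Rightarrow> real).
        R > 0 \<and>
        (\<forall>x\<ge>0. h x \<ge> 0) \<and> antimono_on {0..} h \<and>
        (\<integral>\<^sup>+x\<in>{0..}. ennreal (h x) \<partial>lborel) = 1 \<and>
        (\<forall>x\<ge>0. T x \<ge> 0) \<and> mono_on {0..} T \<and>
        (\<forall>b\<ge>0. abs_continuous_on {0..b} T) \<and> T 0 = 0 \<longrightarrow>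
        (\<integral>\<^sup>+x\<in>{0..}. ennreal (\<bar>clip R (T x) - clip R x\<bar>\<^sup>2 * h x) \<partial>lborel)
          \<le> ennreal C * (\<integral>\<^sup>+x\<in>{0..}. Delta (deriv T x) * ennreal (h x) \<partial>lborel))"

end

theory Submission
  imports Defs
begin

text \<open>
  By duality the bound on the Laplace transform follows from a transport inequality, in which the law
  \<open>\<mu>\<close> of \<open>(\<bar>X\<^sub>1\<bar>, \<dots>, \<bar>X\<^sub>d\<bar>)\<close> is transported monotonically onto its tilt by
  \<open>exp (t F)\<close>: convexity bounds the entropy from below by the integral of
  \<open>\<Delta> (\<partial>\<^sub>i T\<^sub>i)\<close> summed over \<open>i\<close>, the conditional densities on the half-line are nonincreasing,
  and \<open>1 - exp (- a x)\<close> is a mixture of clips, with a Gamma weight in \<open>R\<close>.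

  Densities and multidimensional transport maps are avoided as follows. For \<open>\<delta> > 0\<close> the masses of
  the windows \<open>{z. \<forall>j\<notin>A. \<bar>z\<^sub>j - x\<^sub>j\<bar> \<le> \<delta>}\<close> are log-concave in \<open>x\<close> straight from Borell's definition,
  for every set \<open>A\<close> of coordinates, and they play the role of the marginal densities. Coordinates are
  integrated out one at a time: with the remaining coordinates of source and target frozen at
  \<open>x\<close> and \<open>x'\<close>, a one-dimensional transport shows that a first-order estimate
  \<open>W x' \<le> q x * exp (\<psi> x + c)\<close>, where \<open>c\<close> bounds the slope of \<open>ln q\<close> from \<open>x\<close> to \<open>x'\<close>,
  passes to the marginals. Finally \<open>\<delta>\<close> tends to \<open>0\<close>.
\<close>

section \<open>One-dimensional clipping inequality for exponential profiles\<close>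

text \<open>Log-concave laws may live on a proper subspace and \<open>ln (q A)\<close> may fail to
  be differentiable; this is why masses of boxes stand for densities and one-sided slope bounds for
  gradients. Reflection symmetry and log-concavity together make \<open>q A\<close> nonincreasing
  along each half-axis, the monotonicity that the clipping inequality asks for. Source and target
  points \<open>x\<close> and \<open>x'\<close> must be allowed to differ, because transporting one
  coordinate moves the position at which the remaining ones are compared. The constant C/4 comes
  from completing a square: clipping bounds the second moment of a displacement D by C times the
  cost A, and s D \<le> D^2/C + C s^2/4, so the mean gain is at most A + C s^2/4. The same A, an
  integral of \<open>Delta\<close>, enters the transport estimate with the opposite sign and
  cancels. Summing C s_i^2/4 with s_i = t v_i gives the final exponent.\<close>

lemma lipschitz_imp_abs_continuous_on:
  assumes "L-lipschitz_on S f"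
  shows "abs_continuous_on S f"
  unfolding abs_continuous_on_def
proof (intro allI impI)
  fix e :: real assume e: "e > 0"
  have L: "0 \<le> L" using assms lipschitz_on_nonneg by blast
  show "\<exists>\<delta>>0. \<forall>(n :: nat) (u :: nat \<Rightarrow> real) w.
        (\<forall>i<n. u i \<le> w i \<and> {u i..w i} \<subseteq> S) \<and>
        disjoint_family_on (\<lambda>i. {u i<..<w i}) {..<n} \<and>
        (\<Sum>i<n. w i - u i) < \<delta> \<longrightarrow> (\<Sum>i<n. \<bar>f (w i) - f (u i)\<bar>) < e"
  proof (intro exI[of _ "e / (L + 1)"] conjI allI impI)
    show "0 < e / (L + 1)" using e L by simp
    fix n :: nat and u w :: "nat \<Rightarrow> real"
    assume *: "(\<forall>i<n. u i \<le> w i \<and> {u i..w i} \<subseteq> S) \<and>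
        disjoint_family_on (\<lambda>i. {u i<..<w i}) {..<n} \<and> (\<Sum>i<n. w i - u i) < e / (L + 1)"
    have "(\<Sum>i<n. \<bar>f (w i) - f (u i)\<bar>) \<le> (\<Sum>i<n. L * (w i - u i))"
    proof (rule sum_mono)
      fix i assume "i \<in> {..<n}"
      then have "u i \<le> w i" "{u i..w i} \<subseteq> S" using * by auto
      then have "u i \<in> S" "w i \<in> S" by auto
      then show "\<bar>f (w i) - f (u i)\<bar> \<le> L * (w i - u i)"
        using lipschitz_onD[OF assms, of "w i" "u i"] \<open>u i \<le> w i\<close> by (simp add: dist_real_def)
    qed
    also have "\<dots> \<le> (L + 1) * (\<Sum>i<n. w i - u i)"
      unfolding sum_distrib_left[symmetric]
      using * by (intro mult_right_mono sum_nonneg) auto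
    also have "\<dots> < (L + 1) * (e / (L + 1))"
      using * L by (intro mult_strict_left_mono) auto
    also have "\<dots> = e" using L by simp
    finally show "(\<Sum>i<n. \<bar>f (w i) - f (u i)\<bar>) < e" .
  qed
qed

text \<open>
  The map is continued beyond \<open>b\<close> with slope \<open>1\<close>, which costs nothing because
  \<open>Delta 1 = 0\<close>. This covers maps that blow up at a finite end of the support of \<open>h\<close>.
\<close>

lemma clip_truncated:
  assumes C: "clipping_constant C" and R: "R > 0"
    and h: "\<And>x. x \<ge> 0 \<Longrightarrow> h x \<ge> 0" "antimono_on {0..} h"
      "(\<integral>\<^sup>+x\<in>{0..}. ennreal (h x) \<partial>lborel) = 1"
    and b: "0 \<le> b" and \<tau>: "\<tau> 0 = 0" "mono_on {0..b} \<tau>" "L-lipschitz_on {0..b} \<tau>"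
    and N: "countable N" "\<And>y. y \<in> {0<..<b} - N \<Longrightarrow> (\<tau> has_real_derivative m y) (at y)"
  shows "(\<integral>\<^sup>+y\<in>{0..b}. ennreal (\<bar>clip R (\<tau> y) - clip R y\<bar>\<^sup>2 * h y) \<partial>lborel)
     \<le> ennreal C * (\<integral>\<^sup>+y\<in>{0..b}. Delta (m y) * ennreal (h y) \<partial>lborel)"
proof -
  define T where "T y = (if y \<le> b then \<tau> y else \<tau> b + (y - b))" for y
  \<comment> \<open>The maximum with 1 covers the continuation of slope 1 and makes the constant
    nonnegative.\<close>
  define L' where "L' = max L 1"
  have L'0: "0 \<le> L'" by (simp add: L'_def)
  have T1: "T y' - T y \<le> L' * (y' - y)" "0 \<le> T y' - T y" if "0 \<le> y" "y \<le> y'" for y y'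
  proof -
    have lip: "\<tau> y2 - \<tau> y1 \<le> L' * (y2 - y1)" "0 \<le> \<tau> y2 - \<tau> y1" if "0 \<le> y1" "y1 \<le> y2" "y2 \<le> b" for y1 y2
    proof -
      have "\<bar>\<tau> y2 - \<tau> y1\<bar> \<le> L * (y2 - y1)"
        using lipschitz_onD[OF \<tau>(3), of y2 y1] that by (simp add: dist_real_def)
      also have "\<dots> \<le> L' * (y2 - y1)" using that by (intro mult_right_mono) (auto simp: L'_def)
      finally show "\<tau> y2 - \<tau> y1 \<le> L' * (y2 - y1)" by simp
      show "0 \<le> \<tau> y2 - \<tau> y1" using mono_onD[OF \<tau>(2), of y1 y2] that by simp
    qed
    have one: "z \<le> L' * z" if "0 \<le> z" for z
      using mult_right_mono[of 1 L' z] that by (simp add: L'_def)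
    consider "y' \<le> b" | "y \<le> b" "b < y'" | "b < y" by linarith
    then have "T y' - T y \<le> L' * (y' - y) \<and> 0 \<le> T y' - T y"
    proof cases
      case 1 then show ?thesis using lip[of y y'] that by (auto simp: T_def)
    next
      case 2
      have "L' * (y' - y) = L' * (b - y) + L' * (y' - b)" by (simp add: algebra_simps)
      moreover have "T y' - T y = (\<tau> b - \<tau> y) + (y' - b)" using 2 by (simp add: T_def)
      ultimately show ?thesis using lip[of y b] one[of "y' - b"] that 2 by linarith
    next
      case 3 then show ?thesis using one[of "y' - y"] that by (auto simp: T_def)
    qed
    then show "T y' - T y \<le> L' * (y' - y)" "0 \<le> T y' - T y" by auto
  qed
  have Tlip: "L'-lipschitz_on {0..c} T" for c
  proof (rule lipschitz_onI)
    fix x y assume xy: "x \<in> {0..c}" "y \<in> {0..c}"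
    show "dist (T x) (T y) \<le> L' * dist x y"
      using T1[of x y] T1[of y x] xy by (cases "x \<le> y") (auto simp: dist_real_def)
  qed (rule L'0)
  have T0: "T 0 = 0" using b \<tau> by (simp add: T_def)
  have "(\<integral>\<^sup>+x\<in>{0..}. ennreal (\<bar>clip R (T x) - clip R x\<bar>\<^sup>2 * h x) \<partial>lborel)
          \<le> ennreal C * (\<integral>\<^sup>+x\<in>{0..}. Delta (deriv T x) * ennreal (h x) \<partial>lborel)"
  proof (rule C[unfolded clipping_constant_def, THEN conjunct2, THEN spec, THEN spec, THEN spec, THEN mp],
      intro conjI)
    show "mono_on {0..} T"
    proof (rule mono_onI)
      fix x y :: real assume "x \<in> {0..}" "x \<le> y"
      then show "T x \<le> T y" using T1(2)[of x y] by simp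
    qed
    show "\<forall>x\<ge>0. 0 \<le> T x"
    proof (intro allI impI)
      fix x :: real assume "0 \<le> x"
      then show "0 \<le> T x" using T1(2)[of 0 x] T0 by simp
    qed
    show "\<forall>b\<ge>0. abs_continuous_on {0..b} T"
      using Tlip by (blast intro: lipschitz_imp_abs_continuous_on)
    show "\<forall>x\<ge>0. 0 \<le> h x" using h(1) by blast
  qed (fact R h T0)+
  moreover have "(\<integral>\<^sup>+y\<in>{0..b}. ennreal (\<bar>clip R (\<tau> y) - clip R y\<bar>\<^sup>2 * h y) \<partial>lborel)
     \<le> (\<integral>\<^sup>+x\<in>{0..}. ennreal (\<bar>clip R (T x) - clip R x\<bar>\<^sup>2 * h x) \<partial>lborel)"
    by (intro nn_integral_mono) (auto simp: T_def indicator_def)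
  moreover have "(\<integral>\<^sup>+x\<in>{0..}. Delta (deriv T x) * ennreal (h x) \<partial>lborel)
      \<le> (\<integral>\<^sup>+y\<in>{0..b}. Delta (m y) * ennreal (h y) \<partial>lborel)"
  proof (rule nn_integral_mono_AE)
    \<comment> \<open>Derivatives are compared only off \<open>N\<close> and the two break points, a
      countable and hence null set.\<close>
    have "AE y in lborel. y \<notin> N \<union> {0, b}"
      using N(1) by (intro AE_not_in countable_imp_null_set_lborel) auto
    then show "AE y in lborel. Delta (deriv T y) * ennreal (h y) * indicator {0..} y
        \<le> Delta (m y) * ennreal (h y) * indicator {0..b} y"
    proof eventually_elim
      case (elim y)
      consider "y < 0" | "0 < y" "y < b" | "b < y" using elim by fastforce
      then show ?case
      proof cases
        case 2
        have "(T has_real_derivative m y) (at y)"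
        proof (subst has_field_derivative_cong_ev)
          have "\<forall>\<^sub>F x in nhds y. x \<in> {..<b}" using 2 by (intro eventually_nhds_in_open) auto
          then show "\<forall>\<^sub>F x in nhds y. x \<in> UNIV \<longrightarrow> T x = \<tau> x"
            by eventually_elim (auto simp: T_def)
        qed (use 2 N(2)[of y] elim in \<open>auto simp: T_def\<close>)
        then show ?thesis using 2 by (simp add: DERIV_imp_deriv)
      next
        case 3
        have "((\<lambda>y. \<tau> b + (y - b)) has_real_derivative 1) (at y)" by (auto intro!: derivative_eq_intros)
        then have "(T has_real_derivative 1) (at y)"
        proof (subst has_field_derivative_cong_ev)
          have "\<forall>\<^sub>F x in nhds y. x \<in> {b<..}" using 3 by (intro eventually_nhds_in_open) auto
          then show "\<forall>\<^sub>F x in nhds y. x \<in> UNIV \<longrightarrow> T x = \<tau> b + (x - b)"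
            by eventually_elim (auto simp: T_def)
        qed (use 3 in \<open>auto simp: T_def\<close>)
        then show ?thesis using 3 by (simp add: DERIV_imp_deriv Delta_def)
      qed auto
    qed
  qed
  ultimately show ?thesis
    by (meson mult_left_mono order_trans zero_le)
qed

text \<open>The profile f(x) = 1 - exp (- a x) is concave with f(0) = 0 and slope tending to 0, and
  the slope of \<open>clip R\<close> drops by 1/R at R. Matching second derivatives gives the weight
  - R f''(R) = a^2 R exp (- a R), which is \<open>erlang_density 1 a\<close>.\<close>

lemma erlang_mixture_of_clips:
  assumes a: "a > 0" and x: "x \<ge> 0"
  shows "(LINT R|density lborel (erlang_density 1 a). clip R x) = 1 - exp (- a * x)"
proof -
  have part: "has_bochner_integral lborel (\<lambda>R. erlang_density k a R * indicator {..x} R) (erlang_CDF k a x)" for k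
  proof (rule has_bochner_integral_nn_integral)
    have "(\<integral>\<^sup>+R. ennreal (erlang_density k a R * indicator {..x} R) \<partial>lborel)
        = (\<integral>\<^sup>+R. ennreal (erlang_density k a R) * indicator {..x} R \<partial>lborel)"
      by (intro nn_integral_cong) (simp split: split_indicator)
    then show "(\<integral>\<^sup>+R. ennreal (erlang_density k a R * indicator {..x} R) \<partial>lborel) = ennreal (erlang_CDF k a x)"
      using nn_integral_erlang_density[OF a, of k x] by simp
  qed (use a in \<open>auto intro!: AE_I2\<close>)
  have whole: "has_bochner_integral lborel (erlang_density 0 a) 1"
    using nn_integral_erlang_ith_moment[OF a, of 0 0] a
    by (intro has_bochner_integral_nn_integral) auto
  \<comment> \<open>For R > x the factor 1/R of the clip cancels the R in the density and leaves a
    multiple of \<open>erlang_density 0 a\<close>; for 0 < R \<le> x the clip is 1.\<close>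
  have eq: "erlang_density 1 a R * clip R x = erlang_density 1 a R * indicator {..x} R
      + x * a * (erlang_density 0 a R - erlang_density 0 a R * indicator {..x} R)" for R
    using x by (cases "R \<le> 0"; cases "R \<le> x")
      (auto simp: erlang_density_def clip_def min_def field_simps power2_eq_square)
  have "has_bochner_integral lborel (\<lambda>R. erlang_density 1 a R * clip R x)
     (erlang_CDF 1 a x + x * a * (1 - erlang_CDF 0 a x))"
    unfolding eq by (intro has_bochner_integral_add has_bochner_integral_mult_right
        has_bochner_integral_diff part whole)
  then have "(LINT R|lborel. erlang_density 1 a R * clip R x) = 1 - exp (- a * x)"
    using x a by (auto simp: has_bochner_integral_iff erlang_CDF_def algebra_simps)
  then show ?thesis
    using a by (subst integral_density) (auto simp: clip_def)
qed

text \<open>Such a \<open>J\<close> is an interval starting at 0 without a largest point, of finite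
  or infinite length. Exhausting it from inside lets estimates on the compact pieces
  \<open>{0..b n}\<close> pass to all of \<open>J\<close>.\<close>

lemma cofinal_sequence:
  fixes J :: "real set"
  assumes J0: "0 \<in> J" "J \<subseteq> {0..}" and up: "\<And>y. y \<in> J \<Longrightarrow> \<exists>y'\<in>J. y < y'"
    and down: "\<And>x y. y \<in> J \<Longrightarrow> 0 \<le> x \<Longrightarrow> x \<le> y \<Longrightarrow> x \<in> J"
  obtains b :: "nat \<Rightarrow> real" where "\<And>n. b n \<in> J" "\<And>y. y \<in> J \<Longrightarrow> eventually (\<lambda>n. y \<le> b n) sequentially"
proof (cases "bdd_above J")
  case True
  define s where "s = Sup J"
  have lt: "y < s" if "y \<in> J" for y
    using up[OF that] cSup_upper[OF _ True] unfolding s_def by force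
  have s0: "0 < s" using lt[OF J0(1)] .
  show ?thesis
  proof (rule that[of "\<lambda>n. s * (real n / real (Suc n))"])
    fix n
    have "s * (real n / real (Suc n)) < s" using s0 by (simp add: field_simps)
    moreover have "J \<noteq> {}" using J0(1) by blast
    ultimately have "\<exists>y\<in>J. s * (real n / real (Suc n)) < y"
      using less_cSup_iff[OF _ True] unfolding s_def by simp
    then obtain y where "y \<in> J" "s * (real n / real (Suc n)) < y" ..
    then show "s * (real n / real (Suc n)) \<in> J" using s0 by (auto intro: down[of y])
  next
    fix y assume "y \<in> J"
    have "(\<lambda>n. s * (real n / real (Suc n))) \<longlonglongrightarrow> s * 1"
      by (intro tendsto_mult tendsto_const LIMSEQ_n_over_Suc_n)
    then have "eventually (\<lambda>n. y < s * (real n / real (Suc n))) sequentially"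
      using lt[OF \<open>y \<in> J\<close>] by (intro order_tendstoD) auto
    then show "eventually (\<lambda>n. y \<le> s * (real n / real (Suc n))) sequentially"
      by eventually_elim simp
  qed
next
  case False
  show ?thesis
  proof (rule that[of real])
    fix n
    obtain y where "y \<in> J" "real n < y" using False unfolding bdd_above_def by (meson not_le)
    then show "real n \<in> J" by (auto intro: down[of y])
  next
    fix y :: real
    show "eventually (\<lambda>n. y \<le> real n) sequentially"
      using filterlim_real_sequentially by (auto simp: filterlim_at_top)
  qed
qed

section \<open>Transport cost and the exponential profile\<close>

lemma borel_measurable_Delta [measurable]: "Delta \<in> borel_measurable borel"
  unfolding Delta_def[abs_def] by measurable

text \<open>For each R the clipping inequality bounds the second moment of the clip displacement by
  C A, and completing the square bounds s times its mean by A + C s^2/4. This bound is the same for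
  all R, so it survives averaging over the Gamma weight. The interval \<open>J\<close> carries
  \<open>P\<close>, while \<open>\<tau>\<close> is only locally Lipschitz in it and may blow up at
  its end.\<close>

lemma exp_transport_bound:
  assumes C: "clipping_constant C" and a: "a > 0"
    and h: "\<And>x. x \<ge> 0 \<Longrightarrow> h x \<ge> 0" "antimono_on {0..} h"
      "(\<integral>\<^sup>+x\<in>{0..}. ennreal (h x) \<partial>lborel) = 1"
    and hm[measurable]: "h \<in> borel_measurable borel"
  defines "P \<equiv> density lborel (\<lambda>y. ennreal (h y * indicator {0..} y))"
  assumes J: "0 \<in> J" "J \<subseteq> {0..}" "\<And>y. y \<in> J \<Longrightarrow> \<exists>y'\<in>J. y < y'"
      "\<And>x y. y \<in> J \<Longrightarrow> 0 \<le> x \<Longrightarrow> x \<le> y \<Longrightarrow> x \<in> J" "AE y in P. y \<in> J"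
    and \<tau>: "\<tau> \<in> borel_measurable borel" "\<And>y. 0 \<le> \<tau> y" "\<tau> 0 = 0" "mono_on J \<tau>"
      "\<And>b. b \<in> J \<Longrightarrow> \<exists>L. L-lipschitz_on {0..b} \<tau>"
    and N: "countable N" "\<And>y. y \<in> J - N \<Longrightarrow> (\<tau> has_real_derivative m y) (at y)"
    and m: "m \<in> borel_measurable borel"
    and A: "A \<ge> 0" "(\<integral>\<^sup>+y. Delta (m y) \<partial>P) \<le> ennreal A"
  shows "(LINT y|P. s * ((1 - exp (- a * \<tau> y)) - (1 - exp (- a * y)))) \<le> A + C * s\<^sup>2 / 4"
proof -
  note [measurable] = \<tau>(1) m
  have C0: "C > 0" using C by (simp add: clipping_constant_def)
  have ind: "ennreal (h y * indicator {0..} y) = ennreal (h y) * indicator {0..} y" for y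
    by (simp split: split_indicator)
  interpret P: prob_space P
    by standard (use h(3) in \<open>simp add: P_def emeasure_density ind\<close>)
  have [measurable_cong]: "sets P = sets borel" by (simp add: P_def)
  obtain b where b: "\<And>n. b n \<in> J" "\<And>y. y \<in> J \<Longrightarrow> eventually (\<lambda>n. y \<le> b n) sequentially"
    by (rule cofinal_sequence[OF J(1,2)]) (blast dest: J(3), blast intro: J(4), blast)
  have b0: "0 \<le> b n" for n using b(1) J(2) by auto
  have bJ: "{0..b n} \<subseteq> J" for n using J(4)[OF b(1)[of n]] by auto
  \<comment> \<open>Taking \<bar>y\<bar>, and the value 0 for R \<le> 0, keeps \<open>D\<close>
    bounded by 1 for all arguments, so it is integrable on the product without exceptional
    sets.\<close>
  define D where "D R y = (if R > 0 then clip R (\<tau> y) - clip R \<bar>y\<bar> else 0)" for R y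
  have [measurable]: "case_prod D \<in> borel_measurable (borel \<Otimes>\<^sub>M borel)"
    "(\<lambda>(x, y). D y x) \<in> borel_measurable (borel \<Otimes>\<^sub>M borel)"
    unfolding D_def[abs_def] clip_def by measurable
  have clip01: "0 \<le> clip R x" "clip R x \<le> 1" if "0 < R" "0 \<le> x" for R x
    using that by (auto simp: clip_def)
  have D1: "\<bar>D R y\<bar> \<le> 1" for R y
    using clip01[of R "\<tau> y"] clip01[of R "\<bar>y\<bar>"] \<tau>(2)[of y] unfolding D_def by auto
  have nn: "(\<integral>\<^sup>+y. ennreal ((D R y)\<^sup>2) \<partial>P) \<le> ennreal (C * A)" if R: "R > 0" for R
  proof -
    have bd: "(\<integral>\<^sup>+y. ennreal ((D R y)\<^sup>2) * indicator {..b n} y \<partial>P) \<le> ennreal (C * A)" for n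
    proof -
      obtain L where L: "L-lipschitz_on {0..b n} \<tau>" using \<tau>(5)[OF b(1)[of n]] by blast
      have "(\<integral>\<^sup>+y. ennreal ((D R y)\<^sup>2) * indicator {..b n} y \<partial>P)
          = (\<integral>\<^sup>+y\<in>{0..b n}. ennreal (\<bar>clip R (\<tau> y) - clip R y\<bar>\<^sup>2 * h y) \<partial>lborel)"
        unfolding P_def
      proof (subst nn_integral_density, measurable, rule nn_integral_cong)
        fix y
        show "ennreal (h y * indicator {0..} y) * (ennreal ((D R y)\<^sup>2) * indicator {..b n} y)
            = ennreal (\<bar>clip R (\<tau> y) - clip R y\<bar>\<^sup>2 * h y) * indicator {0..b n} y"
          using R h(1)[of y] by (simp add: D_def ennreal_mult'' mult.commute split: split_indicator)
      qed
      also have "\<dots> \<le> ennreal C * (\<integral>\<^sup>+y\<in>{0..b n}. Delta (m y) * ennreal (h y) \<partial>lborel)"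
      proof (rule clip_truncated[OF C R h b0 \<tau>(3) _ L N(1)])
        show "mono_on {0..b n} \<tau>" using \<tau>(4) bJ by (rule mono_on_subset)
        show "(\<tau> has_real_derivative m y) (at y)" if "y \<in> {0<..<b n} - N" for y
          using that bJ[of n] by (intro N(2)) auto
      qed
      also have "(\<integral>\<^sup>+y\<in>{0..b n}. Delta (m y) * ennreal (h y) \<partial>lborel) \<le> (\<integral>\<^sup>+y. Delta (m y) \<partial>P)"
        unfolding P_def
        by (subst nn_integral_density, measurable, rule nn_integral_mono)
           (simp add: mult.commute split: split_indicator)
      also have "\<dots> \<le> ennreal A" by (rule A(2))
      finally show ?thesis using A C0 by (simp add: ennreal_mult mult_left_mono)
    qed
    \<comment> \<open>Fatou's lemma: almost every y lies in \<open>J\<close>, where the cutoff at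
      \<open>b n\<close> is eventually 1.\<close>
    have "(\<integral>\<^sup>+y. ennreal ((D R y)\<^sup>2) \<partial>P) \<le> (\<integral>\<^sup>+y. liminf (\<lambda>n. ennreal ((D R y)\<^sup>2) * indicator {..b n} y) \<partial>P)"
    proof (rule nn_integral_mono_AE)
      show "AE y in P. ennreal ((D R y)\<^sup>2) \<le> liminf (\<lambda>n. ennreal ((D R y)\<^sup>2) * indicator {..b n} y)"
        using J(5)
      proof eventually_elim
        case (elim y)
        show ?case
          by (rule Liminf_bounded, rule eventually_mono[OF b(2)[OF elim]]) simp
      qed
    qed
    also have "\<dots> \<le> liminf (\<lambda>n. \<integral>\<^sup>+y. ennreal ((D R y)\<^sup>2) * indicator {..b n} y \<partial>P)"
      by (intro nn_integral_liminf) measurable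
    also have "\<dots> \<le> limsup (\<lambda>n. \<integral>\<^sup>+y. ennreal ((D R y)\<^sup>2) * indicator {..b n} y \<partial>P)"
      by (rule Liminf_le_Limsup) simp
    also have "\<dots> \<le> ennreal (C * A)"
      using bd by (intro Limsup_bounded always_eventually) auto
    finally show ?thesis .
  qed
  have Dint: "integrable P (D R)" "integrable P (\<lambda>y. (D R y)\<^sup>2)" for R
    using D1 by (auto intro!: P.integrable_const_bound[where B=1] simp: abs_square_le_1)
  have fixR: "(LINT y|P. s * D R y) \<le> A + C * s\<^sup>2 / 4" for R
  proof (cases "R > 0")
    case False
    then show ?thesis using A(1) C0 by (simp add: D_def)
  next
    case True
    have sq: "(LINT y|P. (D R y)\<^sup>2) \<le> C * A"
      using nn[OF True] A(1) C0 Dint(2)[of R] by (subst (asm) nn_integral_eq_integral) auto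
    \<comment> \<open>Young's inequality with weight C: the square behind it is (D - C s/2)^2 /
      C.\<close>
    have "s * D R y \<le> (D R y)\<^sup>2 / C + C * s\<^sup>2 / 4" for y
    proof -
      have "0 \<le> (D R y - C * s / 2)\<^sup>2 / C" using C0 by simp
      also have "\<dots> = (D R y)\<^sup>2 / C + C * s\<^sup>2 / 4 - s * D R y"
        using C0 by (simp add: power2_eq_square field_simps)
      finally show ?thesis by simp
    qed
    then have "(LINT y|P. s * D R y) \<le> (LINT y|P. (D R y)\<^sup>2 / C + C * s\<^sup>2 / 4)"
      by (intro integral_mono integrable_mult_right Bochner_Integration.integrable_add
          integrable_divide_zero Dint P.integrable_const) auto
    also have "\<dots> = (LINT y|P. (D R y)\<^sup>2) / C + C * s\<^sup>2 / 4"
      using Dint(2)[of R] by (simp add: P.prob_space)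
    also have "\<dots> \<le> A + C * s\<^sup>2 / 4" using sq C0 by (simp add: field_simps)
    finally show ?thesis .
  qed
  define \<Gamma> where "\<Gamma> = density lborel (erlang_density 1 a)"
  interpret G: prob_space \<Gamma> unfolding \<Gamma>_def using a by (rule prob_space_erlang_density)
  have [measurable_cong]: "sets \<Gamma> = sets borel" by (simp add: \<Gamma>_def)
  interpret PG: pair_prob_space P \<Gamma> ..
  have int: "integrable (P \<Otimes>\<^sub>M \<Gamma>) (\<lambda>(y, R). s * D R y)"
    using D1 by (intro PG.integrable_const_bound[where B="\<bar>s\<bar>"])
      (auto simp: abs_mult mult_left_le)
  have Gpos: "AE R in \<Gamma>. R > 0"
  proof -
    have "AE R in lborel. R \<noteq> (0::real)" by (rule AE_lborel_singleton)
    then show ?thesis unfolding \<Gamma>_def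
      by (subst AE_density, measurable, eventually_elim) (auto simp: erlang_density_def)
  qed
  have mix: "(LINT R|\<Gamma>. D R y) = (1 - exp (- a * \<tau> y)) - (1 - exp (- a * y))" if y: "0 \<le> y" for y
  proof -
    have bnd: "integrable \<Gamma> (\<lambda>R. clip R x)" if "0 \<le> x" for x
    proof (rule G.integrable_const_bound[where B=1])
      show "AE R in \<Gamma>. norm (clip R x) \<le> 1"
        using Gpos by eventually_elim (use that clip01 in auto)
    qed (simp add: clip_def)
    have "(LINT R|\<Gamma>. D R y) = (LINT R|\<Gamma>. clip R (\<tau> y) - clip R y)"
    proof (rule integral_cong_AE)
      show "AE R in \<Gamma>. D R y = clip R (\<tau> y) - clip R y"
        using Gpos by eventually_elim (use y in \<open>simp add: D_def\<close>)
    qed (auto simp: clip_def)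
    also have "\<dots> = (1 - exp (- a * \<tau> y)) - (1 - exp (- a * y))"
      using erlang_mixture_of_clips[OF a y] erlang_mixture_of_clips[OF a \<tau>(2)[of y]] bnd[OF y] bnd[OF \<tau>(2)]
      by (simp add: \<Gamma>_def)
    finally show ?thesis .
  qed
  have "(LINT y|P. s * ((1 - exp (- a * \<tau> y)) - (1 - exp (- a * y)))) = (LINT y|P. (LINT R|\<Gamma>. s * D R y))"
  proof (rule integral_cong_AE)
    show "AE y in P. s * ((1 - exp (- a * \<tau> y)) - (1 - exp (- a * y))) = (LINT R|\<Gamma>. s * D R y)"
      using J(5) by eventually_elim (use J(2) mix in auto)
  qed measurable
  also have "\<dots> = (LINT R|\<Gamma>. (LINT y|P. s * D R y))"
    by (rule PG.Fubini_integral[OF int, symmetric])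
  also have "\<dots> \<le> (LINT R|\<Gamma>. A + C * s\<^sup>2 / 4)"
    using fixR PG.integrable_snd[OF int] by (intro integral_mono) auto
  also have "\<dots> = A + C * s\<^sup>2 / 4" by (simp add: G.prob_space)
  finally show ?thesis .
qed

section \<open>Monotone transport on the half-line\<close>

lemma primitive_of_integrable:
  fixes k :: "real \<Rightarrow> real"
  assumes k: "set_integrable lborel {0..} k"
    and K_def: "K = (\<lambda>y. LINT x:{0..y}|lborel. k x)"
  shows "K 0 = 0" "(K \<longlongrightarrow> (LINT x:{0..}|lborel. k x)) at_top"
    "\<And>y y'. 0 \<le> y \<Longrightarrow> y \<le> y' \<Longrightarrow> K y' - K y = (LINT x:{y<..y'}|lborel. k x)"
    "\<And>y. 0 < y \<Longrightarrow> isCont k y \<Longrightarrow> (K has_real_derivative k y) (at y)"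
proof -
  have sub: "set_integrable lborel S k" if "S \<subseteq> {0..}" "S \<in> sets borel" for S
    using set_integrable_subset[OF k] that by auto
  show "K 0 = 0"
    unfolding K_def set_lebesgue_integral_def
  proof (rule integral_eq_zero_AE)
    show "AE x in lborel. indicator {0..0} x *\<^sub>R k x = 0"
      using AE_lborel_singleton[of "0::real"] by eventually_elim simp
  qed
  show "(K \<longlongrightarrow> (LINT x:{0..}|lborel. k x)) at_top"
    unfolding K_def by (rule tendsto_set_lebesgue_integral_at_top) (use k in auto)
  show "K y' - K y = (LINT x:{y<..y'}|lborel. k x)" if "0 \<le> y" "y \<le> y'" for y y'
  proof -
    have "{0..y'} = {0..y} \<union> {y<..y'}" using that by auto
    then have "K y' = K y + (LINT x:{y<..y'}|lborel. k x)"
      unfolding K_def using that by (simp only:) (rule set_integral_Un, auto intro!: sub)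
    then show ?thesis by simp
  qed
  show "(K has_real_derivative k y) (at y)" if y: "0 < y" "isCont k y" for y
  proof -
    have eq: "K = (\<lambda>u. integral {0..u} k)"
      unfolding K_def by (rule ext, rule set_borel_integral_eq_integral) (auto intro: sub)
    have "((\<lambda>u. integral {0..u} k) has_vector_derivative k y) (at y within ({0..y + 1} - {}))"
      using y by (intro integral_has_vector_derivative_continuous_at set_borel_integral_eq_integral sub)
        (auto intro: continuous_at_imp_continuous_at_within)
    moreover have "at y within ({0..y + 1} - {}) = at y"
      using y by (intro at_within_interior) auto
    ultimately show ?thesis
      by (simp add: eq has_real_derivative_iff_has_vector_derivative)
  qed
qed

lemma primitive_increment_bounds:
  fixes k :: "real \<Rightarrow> real"
  assumes k: "set_integrable lborel {0..} k"
    and y: "0 \<le> y" "y \<le> y'"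
  shows "(\<And>x. y < x \<Longrightarrow> x \<le> y' \<Longrightarrow> c \<le> k x) \<Longrightarrow> c * (y' - y) \<le> (LINT x:{y<..y'}|lborel. k x)"
    and "(\<And>x. y < x \<Longrightarrow> x \<le> y' \<Longrightarrow> k x \<le> c) \<Longrightarrow> (LINT x:{y<..y'}|lborel. k x) \<le> c * (y' - y)"
proof -
  have int: "set_integrable lborel {y<..y'} k"
    using y by (intro set_integrable_subset[OF k]) auto
  have c: "(LINT x:{y<..y'}|lborel. c) = c * (y' - y)" "set_integrable lborel {y<..y'} (\<lambda>x. c)"
    using y by (auto simp: set_lebesgue_integral_def set_integrable_def)
  show "c * (y' - y) \<le> (LINT x:{y<..y'}|lborel. k x)" if "\<And>x. y < x \<Longrightarrow> x \<le> y' \<Longrightarrow> c \<le> k x"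
    unfolding c(1)[symmetric] using that by (intro set_integral_mono int c(2)) auto
  show "(LINT x:{y<..y'}|lborel. k x) \<le> c * (y' - y)" if "\<And>x. y < x \<Longrightarrow> x \<le> y' \<Longrightarrow> k x \<le> c"
    unfolding c(1)[symmetric] using that by (intro set_integral_mono int c(2)) auto
qed

text \<open>\<open>G\<close> inverts the distribution function \<open>K\<close>. As \<open>k\<close>
  is not assumed monotone, the inverse is controlled by the nonincreasing minorant \<open>q\<close>:
  on [0, G u] the density is at least q (G u) > 0, which makes \<open>G\<close> Lipschitz on [0, u].
  The bound \<open>M\<close> gives continuity of \<open>K\<close>, and the common zeros of
  \<open>q\<close> and \<open>k\<close> exclude mass beyond a zero of \<open>q\<close>.\<close>

lemma quantile_function:
  fixes k q :: "real \<Rightarrow> real"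
  assumes k: "set_integrable lborel {0..} k" "\<And>y. 0 \<le> y \<Longrightarrow> 0 \<le> k y" "\<And>y. 0 \<le> y \<Longrightarrow> k y \<le> M"
    and Ktot: "(LINT x:{0..}|lborel. k x) = 1"
    and q: "antimono_on {0..} q" "\<And>y. 0 \<le> y \<Longrightarrow> q y \<le> k y" "\<And>y. 0 \<le> y \<Longrightarrow> 0 \<le> q y"
      "\<And>y. 0 \<le> y \<Longrightarrow> q y = 0 \<Longrightarrow> k y = 0"
    and K_def: "K = (\<lambda>y. LINT x:{0..y}|lborel. k x)"
  obtains G where "G 0 = 0" "\<And>u. 0 \<le> u \<Longrightarrow> u < 1 \<Longrightarrow> 0 \<le> G u \<and> K (G u) = u \<and> q (G u) > 0"
    "strict_mono_on {0..<1} G" "\<And>u. u < 1 \<Longrightarrow> \<exists>L. L-lipschitz_on {0..u} G"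
    "\<And>u. 0 < u \<Longrightarrow> u < 1 \<Longrightarrow> isCont k (G u) \<Longrightarrow> (G has_real_derivative 1 / k (G u)) (at u)"
proof -
  note K = primitive_of_integrable[OF k(1) K_def]
  have low: "q y' * (y' - y) \<le> K y' - K y" if "0 \<le> y" "y \<le> y'" for y y'
  proof -
    have "q y' \<le> k x" if "y < x" "x \<le> y'" for x
      using monotone_onD[OF q(1), of x y'] q(2)[of x] that \<open>0 \<le> y\<close> by auto
    then show ?thesis using primitive_increment_bounds(1)[OF k(1) that] K(3)[OF that] by simp
  qed
  have up: "K y' - K y \<le> M * (y' - y)" if "0 \<le> y" "y \<le> y'" for y y'
    using primitive_increment_bounds(2)[OF k(1) that, of M] K(3)[OF that] k(3) that by simp
  have Kmono: "K y \<le> K y'" if "0 \<le> y" "y \<le> y'" for y y'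
  proof -
    have "0 \<le> q y' * (y' - y)" using that q(3)[of y'] by simp
    then show ?thesis using low[OF that] by simp
  qed
  have M0: "0 \<le> M" using k(2,3)[of 0] by simp
  have "M-lipschitz_on {0..} K"
  proof (rule lipschitz_onI[OF _ M0])
    fix x y :: real assume "x \<in> {0..}" "y \<in> {0..}"
    then show "dist (K x) (K y) \<le> M * dist x y"
      using up[of x y] up[of y x] Kmono[of x y] Kmono[of y x]
      by (cases "x \<le> y") (auto simp: dist_real_def)
  qed
  then have Kcont: "continuous_on {0..} K" by (rule lipschitz_on_continuous_on)
  \<comment> \<open>If \<open>q\<close> vanished at y, then by monotonicity \<open>q\<close>, hence
    \<open>k\<close>, would vanish beyond y, and \<open>K\<close> would already have reached its
    limit 1.\<close>
  have qpos: "q y > 0" if "0 \<le> y" "K y < 1" for y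
  proof (rule ccontr)
    assume "\<not> q y > 0"
    then have q0: "q y = 0" using q(3)[of y] that by simp
    have "K x = K y" if "y \<le> x" for x
    proof -
      have "k z = 0" if "y < z" for z
        using monotone_onD[OF q(1), of y z] q0 q(3)[of z] q(4)[of z] that \<open>0 \<le> y\<close> by auto
      then have "K x - K y \<le> 0 * (x - y)"
        using primitive_increment_bounds(2)[OF k(1) \<open>0 \<le> y\<close> that, of 0] K(3)[OF \<open>0 \<le> y\<close> that] by simp
      then show ?thesis using Kmono[OF \<open>0 \<le> y\<close> that] by simp
    qed
    then have "(K \<longlongrightarrow> K y) at_top"
      using eventually_mono[OF eventually_ge_at_top[of y], of "\<lambda>x. K x = K y"]
      by (intro tendsto_eventually) blast
    then have "K y = 1" using tendsto_unique[OF trivial_limit_at_top_linorder _ K(2)] Ktot by metis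
    then show False using that by simp
  qed
  have ex: "\<exists>y\<ge>0. K y = u" if "0 \<le> u" "u < 1" for u
  proof -
    have "eventually (\<lambda>y. u < K y) at_top" using K(2) Ktot that by (intro order_tendstoD) auto
    then have "eventually (\<lambda>y. u < K y \<and> 0 \<le> y) at_top"
      using eventually_ge_at_top[of 0] by eventually_elim simp
    then obtain Y where "u < K Y" "0 \<le> Y" by (auto dest!: eventually_happens)
    moreover have "continuous_on {0..Y} K" using Kcont by (rule continuous_on_subset) auto
    ultimately show ?thesis using IVT'[of K 0 u Y] K(1) that by auto
  qed
  define G where "G u = (SOME y. 0 \<le> y \<and> K y = u)" for u
  have G: "0 \<le> G u" "K (G u) = u" "q (G u) > 0" if "0 \<le> u" "u < 1" for u
  proof -
    have "0 \<le> G u \<and> K (G u) = u" unfolding G_def using ex[OF that] by (rule someI_ex)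
    then show "0 \<le> G u" "K (G u) = u" "q (G u) > 0" using qpos[of "G u"] that by auto
  qed
  have Gs: "G u < G u'" if "0 \<le> u" "u < u'" "u' < 1" for u u'
    using Kmono[of "G u'" "G u"] G[of u] G[of u'] that by (cases "G u' \<le> G u") auto
  have Glip: "\<exists>L. L-lipschitz_on {0..u} G" if u: "u < 1" for u
  proof (cases "0 \<le> u")
    case False
    then show ?thesis by (auto intro!: exI[of _ 0] lipschitz_onI)
  next
    case True
    let ?c = "q (G u)"
    have c: "?c > 0" using G True u by simp
    have *: "\<bar>G y - G x\<bar> \<le> 1 / ?c * (y - x)" if "0 \<le> x" "x \<le> y" "y \<le> u" for x y
    proof (cases "x = y")
      case False
      then have xy: "G x < G y" "G y \<le> G u" using Gs[of x y] Gs[of y u] that u by (cases "y = u"; auto)+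
      have "?c \<le> q (G y)"
        using monotone_onD[OF q(1), of "G y" "G u"] G[of y] G[of u] xy that u by auto
      then have "?c * (G y - G x) \<le> q (G y) * (G y - G x)" using xy by (intro mult_right_mono) auto
      also have "\<dots> \<le> y - x" using low[of "G x" "G y"] G[of x] G[of y] that u xy by auto
      finally show ?thesis using c xy by (simp add: field_simps)
    qed simp
    have "(1 / ?c)-lipschitz_on {0..u} G"
    proof (rule lipschitz_onI)
      fix x y assume "x \<in> {0..u}" "y \<in> {0..u}"
      then show "dist (G x) (G y) \<le> 1 / ?c * dist x y"
        using *[of x y] *[of y x] by (cases "x \<le> y") (auto simp: dist_real_def abs_minus_commute)
    qed (use c in simp)
    then show ?thesis by blast
  qed
  have Gder: "(G has_real_derivative 1 / k (G u)) (at u)" if u: "0 < u" "u < 1" "isCont k (G u)" for u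
  proof -
    have "G u \<noteq> 0" using K(1) G(2)[of u] u by auto
    then have "0 < G u" using G(1)[of u] u by simp
    then have "(K has_real_derivative k (G u)) (at (G u))" using K(4) u by blast
    moreover have "k (G u) \<noteq> 0" using q(2)[of "G u"] G[of u] u by auto
    moreover have "isCont G u"
    proof -
      obtain u' where "u < u'" "u' < 1" using dense[of u 1] u by auto
      then obtain L where "L-lipschitz_on {0..u'} G" using Glip by blast
      then have "continuous_on {0..u'} G" by (rule lipschitz_on_continuous_on)
      then show ?thesis using \<open>u < u'\<close> u by (intro continuous_on_interior[of "{0..u'}"]) auto
    qed
    ultimately have "(G has_real_derivative inverse (k (G u))) (at u)"
      using u by (intro DERIV_inverse_function[where a=0 and b=1]) (auto intro: G(2))
    then show ?thesis by (simp add: field_simps)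
  qed
  show ?thesis
  proof (rule that[of G])
    \<comment> \<open>\<open>K (G 0)\<close> is 0 and \<open>q (G 0)\<close> is positive, so the
      lower slope bound leaves only the value 0.\<close>
    have "q (G 0) * (G 0 - 0) \<le> 0" using low[of 0 "G 0"] G[of 0] K(1) by simp
    then show "G 0 = 0" using G[of 0] by (simp add: mult_le_0_iff)
    show "strict_mono_on {0..<1} G" using Gs by (intro strict_mono_onI) auto
  qed (use G Glip Gder in auto)
qed

text \<open>For nonincreasing \<open>h\<close> this is the support interval without its right end.
  Asking for a strictly later point of positivity keeps the distribution function below 1, where the
  quantile function of the target is under control, even if the end itself has positive
  density.\<close>

definition before_end :: "(real \<Rightarrow> real) \<Rightarrow> real set" where
  "before_end h = {y. 0 \<le> y \<and> (\<exists>y'>y. 0 < h y')}"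

lemma before_end_props:
  fixes h :: "real \<Rightarrow> real"
  assumes h: "\<forall>x\<ge>0. h x \<ge> 0" "antimono_on {0..} h"
    and int: "(LINT x:{0..}|lborel. h x) = 1"
  shows "0 \<in> before_end h" "before_end h \<subseteq> {0..}" "\<And>y. y \<in> before_end h \<Longrightarrow> \<exists>y'\<in>before_end h. y < y'"
    "\<And>x y. y \<in> before_end h \<Longrightarrow> 0 \<le> x \<Longrightarrow> x \<le> y \<Longrightarrow> x \<in> before_end h"
    "AE y in lborel. 0 \<le> y \<longrightarrow> h y \<noteq> 0 \<longrightarrow> y \<in> before_end h"
    "before_end h \<in> sets borel" "\<And>y. y \<in> before_end h \<Longrightarrow> 0 < h y"
proof -
  show sub: "before_end h \<subseteq> {0..}" by (auto simp: before_end_def)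
  show up: "\<exists>y'\<in>before_end h. y < y'" if "y \<in> before_end h" for y
  proof -
    obtain y' where "0 \<le> y" "y < y'" "0 < h y'" using \<open>y \<in> _\<close> by (auto simp: before_end_def)
    moreover from this obtain z where "y < z" "z < y'" using dense by blast
    ultimately show ?thesis by (intro bexI[of _ z]) (auto simp: before_end_def)
  qed
  show down: "x \<in> before_end h" if "y \<in> before_end h" "0 \<le> x" "x \<le> y" for x y
    using that unfolding before_end_def by (auto intro: le_less_trans)
  show "0 < h y" if yJ: "y \<in> before_end h" for y
  proof -
    obtain y' where "0 \<le> y" "y < y'" "0 < h y'" using yJ by (auto simp: before_end_def)
    then show ?thesis using monotone_onD[OF h(2), of y y'] by auto
  qed
  \<comment> \<open>Of two such points the smaller one would have a later point of positivity; so at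
    most the right end of the support is missed.\<close>
  have two: "x = y" if "x \<notin> before_end h" "y \<notin> before_end h" "0 \<le> x" "0 \<le> y" "h x \<noteq> 0" "h y \<noteq> 0" for x y
    using that h(1)[rule_format, of x] h(1)[rule_format, of y] unfolding before_end_def
    by (metis (mono_tags, lifting) less_le linorder_less_linear mem_Collect_eq)
  show AE: "AE y in lborel. 0 \<le> y \<longrightarrow> h y \<noteq> 0 \<longrightarrow> y \<in> before_end h"
  proof (cases "\<exists>z. 0 \<le> z \<and> h z \<noteq> 0 \<and> z \<notin> before_end h")
    case True
    then obtain z where z: "0 \<le> z" "h z \<noteq> 0" "z \<notin> before_end h" by blast
    show ?thesis
      using AE_lborel_singleton[of z] by eventually_elim (use two[OF _ z(3) _ z(1) _ z(2)] in blast)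
  qed auto
  show "0 \<in> before_end h"
  proof (rule ccontr)
    assume "0 \<notin> before_end h"
    then have empty: "y \<notin> before_end h" for y using down[of y 0] sub by force
    have "(LINT x:{0..}|lborel. h x) = 0"
      unfolding set_lebesgue_integral_def
    proof (rule integral_eq_zero_AE)
      show "AE x in lborel. indicator {0..} x *\<^sub>R h x = 0"
        using AE by eventually_elim (use empty in \<open>auto simp: indicator_def\<close>)
    qed
    then show False using int by simp
  qed
  have "before_end h = {0..} \<inter> (\<Union>y'\<in>{y'. 0 < h y'}. {..<y'})"
    by (auto simp: before_end_def)
  moreover have "open (\<Union>y'\<in>{y'. 0 < h y'}. {..<y'})" by (intro open_UN) auto
  ultimately show "before_end h \<in> sets borel" by (metis borel_open sets.Int closed_atLeast borel_closed)
qed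

text \<open>The map is the quantile function of the target after the distribution function of the
  source, and the chain rule gives its derivative. Exceptions are 0, discontinuities of the monotone
  \<open>h\<close>, and points sent to discontinuities of \<open>k\<close>; the last are countably
  many because \<open>\<tau>\<close> is injective.\<close>

lemma monotone_transport:
  fixes h k q :: "real \<Rightarrow> real"
  assumes h: "\<And>x. x \<ge> 0 \<Longrightarrow> h x \<ge> 0" "antimono_on {0..} h" "set_integrable lborel {0..} h"
      "(LINT x:{0..}|lborel. h x) = 1"
    and k: "set_integrable lborel {0..} k" "\<And>y. 0 \<le> y \<Longrightarrow> 0 \<le> k y" "\<And>y. 0 \<le> y \<Longrightarrow> k y \<le> M"
      "(LINT x:{0..}|lborel. k x) = 1" "countable {y. 0 < y \<and> \<not> isCont k y}"
    and q: "antimono_on {0..} q" "\<And>y. 0 \<le> y \<Longrightarrow> q y \<le> k y" "\<And>y. 0 \<le> y \<Longrightarrow> 0 \<le> q y"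
      "\<And>y. 0 \<le> y \<Longrightarrow> q y = 0 \<Longrightarrow> k y = 0"
  obtains \<tau> N where "\<tau> \<in> borel_measurable borel" "\<And>y. 0 \<le> \<tau> y" "\<tau> 0 = 0"
    "strict_mono_on (before_end h) \<tau>"
    "\<And>b. b \<in> before_end h \<Longrightarrow> \<exists>L. L-lipschitz_on {0..b} \<tau>"
    "countable N" "\<And>y. y \<in> before_end h - N \<Longrightarrow> (\<tau> has_real_derivative h y / k (\<tau> y)) (at y)"
    "\<And>y. y \<in> before_end h \<Longrightarrow> 0 < q (\<tau> y)"
proof -
  let ?J = "before_end h"
  have "\<forall>x\<ge>0. h x \<ge> 0" using h(1) by blast
  note J = before_end_props[OF this h(2,4)]
  define K where "K = (\<lambda>y. LINT x:{0..y}|lborel. k x)"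
  define H where "H = (\<lambda>y. LINT x:{0..y}|lborel. h x)"
  note H = primitive_of_integrable[OF h(3) H_def]
  obtain G where G: "G 0 = 0" "\<And>u. 0 \<le> u \<Longrightarrow> u < 1 \<Longrightarrow> 0 \<le> G u \<and> K (G u) = u \<and> q (G u) > 0"
    "strict_mono_on {0..<1} G" "\<And>u. u < 1 \<Longrightarrow> \<exists>L. L-lipschitz_on {0..u} G"
    "\<And>u. 0 < u \<Longrightarrow> u < 1 \<Longrightarrow> isCont k (G u) \<Longrightarrow> (G has_real_derivative 1 / k (G u)) (at u)"
    by (rule quantile_function[OF k(1-4) q(1-4) K_def]) blast+
  have low: "h y' * (y' - y) \<le> H y' - H y" if "0 \<le> y" "y \<le> y'" for y y'
  proof -
    have "h y' \<le> h x" if "y < x" "x \<le> y'" for x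
      using monotone_onD[OF h(2), of x y'] that \<open>0 \<le> y\<close> by auto
    then show ?thesis using primitive_increment_bounds(1)[OF h(3) that] H(3)[OF that] by simp
  qed
  have up: "H y' - H y \<le> h 0 * (y' - y)" if "0 \<le> y" "y \<le> y'" for y y'
  proof -
    have "h x \<le> h 0" if "y < x" "x \<le> y'" for x
      using monotone_onD[OF h(2), of 0 x] that \<open>0 \<le> y\<close> by auto
    then show ?thesis using primitive_increment_bounds(2)[OF h(3) that] H(3)[OF that] by simp
  qed
  have Hmono: "H y \<le> H y'" if "0 \<le> y" "y \<le> y'" for y y'
    using low[OF that] mult_nonneg_nonneg[of "h y'" "y' - y"] h(1)[of y'] that by linarith
  have H1: "H y \<le> 1" if "0 \<le> y" for y
    using H(2) unfolding h(4)
    by (rule tendsto_lowerbound)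
      (use that in \<open>auto intro!: eventually_mono[OF eventually_ge_at_top[of y]] Hmono\<close>)
  \<comment> \<open>Positivity at the right end suffices, since \<open>h\<close> is at least
    \<open>h y'\<close> on the whole interval.\<close>
  have Hs: "H y < H y'" if "0 \<le> y" "y < y'" "0 < h y'" for y y'
    using low[of y y'] mult_pos_pos[of "h y'" "y' - y"] that by linarith
  have HJ: "0 \<le> H y" "H y < 1" if yJ: "y \<in> ?J" for y
  proof -
    obtain y' where y': "0 \<le> y" "y < y'" "0 < h y'" using yJ by (auto simp: before_end_def)
    show "H y < 1" using Hs[OF y'] H1[of y'] y' by simp
    show "0 \<le> H y" using Hmono[of 0 y] H(1) y' by simp
  qed
  \<comment> \<open>The default 0 off \<open>before_end h\<close> keeps \<open>\<tau>\<close>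
    nonnegative and Borel, as it is monotone on each of two Borel pieces.\<close>
  define \<tau> where "\<tau> y = (if y \<in> ?J then G (H y) else 0)" for y
  have sm: "strict_mono_on ?J \<tau>"
  proof (rule strict_mono_onI)
    fix y y' assume y: "y \<in> ?J" "y' \<in> ?J" "y < y'"
    then have "H y < H y'" using J(2) J(7)[of y'] by (intro Hs) auto
    then show "\<tau> y < \<tau> y'" using strict_mono_onD[OF G(3), of "H y" "H y'"] HJ[of y] HJ[of y'] y
      by (simp add: \<tau>_def)
  qed
  have lip: "\<exists>L. L-lipschitz_on {0..b} \<tau>" if b: "b \<in> ?J" for b
  proof -
    have bJ: "{0..b} \<subseteq> ?J" using J(4)[OF b] by auto
    obtain L where L: "L-lipschitz_on {0..H b} G" using G(4) HJ(2)[OF b] by blast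
    have "(h 0)-lipschitz_on {0..b} H"
    proof (rule lipschitz_onI)
      fix x y :: real assume "x \<in> {0..b}" "y \<in> {0..b}"
      then show "dist (H x) (H y) \<le> h 0 * dist x y"
        using up[of x y] up[of y x] Hmono[of x y] Hmono[of y x]
        by (cases "x \<le> y") (auto simp: dist_real_def)
    qed (use h(1)[of 0] in simp)
    moreover have "H ` {0..b} \<subseteq> {0..H b}" using bJ HJ(1) Hmono by auto
    then have "L-lipschitz_on (H ` {0..b}) G" using L by (rule lipschitz_on_subset[rotated])
    ultimately have "(L * h 0)-lipschitz_on {0..b} (\<lambda>y. G (H y))" by (rule lipschitz_on_compose2)
    then have "(L * h 0)-lipschitz_on {0..b} \<tau>"
      by (rule lipschitz_on_transform) (use bJ in \<open>auto simp: \<tau>_def\<close>)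
    then show ?thesis by blast
  qed
  have inj: "inj_on \<tau> ?J" using sm by (rule strict_mono_on_imp_inj_on)
  define N where "N = {0} \<union> {y\<in>{0<..}. \<not> isCont h y} \<union> {y\<in>?J. 0 < \<tau> y \<and> \<not> isCont k (\<tau> y)}"
  have "countable {y\<in>?J. 0 < \<tau> y \<and> \<not> isCont k (\<tau> y)}"
  proof (rule countable_image_inj_on)
    show "countable (\<tau> ` {y\<in>?J. 0 < \<tau> y \<and> \<not> isCont k (\<tau> y)})"
      by (rule countable_subset[OF _ k(5)]) auto
    show "inj_on \<tau> {y\<in>?J. 0 < \<tau> y \<and> \<not> isCont k (\<tau> y)}" by (rule inj_on_subset[OF inj]) auto
  qed
  moreover have "countable {y\<in>{0<..}. \<not> isCont h y}"
  proof -
    have "mono_on {0<..} (\<lambda>y. - h y)"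
      using monotone_onD[OF h(2)] by (intro mono_onI) auto
    then have "countable {y\<in>{0<..}. \<not> isCont (\<lambda>y. - h y) y}"
      by (intro mono_on_ctble_discont_open) auto
    moreover have "isCont (\<lambda>y. - h y) y \<longleftrightarrow> isCont h y" for y
      using continuous_minus[of "at y" h] continuous_minus[of "at y" "\<lambda>y. - h y"] by auto
    ultimately show ?thesis by simp
  qed
  ultimately have N: "countable N" by (simp add: N_def)
  have der: "(\<tau> has_real_derivative h y / k (\<tau> y)) (at y)" if y: "y \<in> ?J - N" for y
  proof -
    have y0: "0 < y" using y J(2) by (auto simp: N_def)
    obtain y' where y': "y' \<in> ?J" "y < y'" using J(3) y by blast
    have Hy: "0 < H y" using Hs[of 0 y] H(1) J(7)[of y] y y0 by simp
    have \<tau>0: "0 < \<tau> y" using strict_mono_onD[OF G(3), of 0 "H y"] HJ[of y] Hy y G(1) by (simp add: \<tau>_def)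
    have "(H has_real_derivative h y) (at y)" using y y0 by (intro H(4)) (auto simp: N_def)
    moreover have "(G has_real_derivative 1 / k (G (H y))) (at (H y))"
      using Hy HJ[of y] y \<tau>0 by (intro G(5)) (auto simp: N_def \<tau>_def)
    ultimately have "((\<lambda>y. G (H y)) has_real_derivative 1 / k (G (H y)) * h y) (at y)"
      by (rule DERIV_chain2[rotated])
    moreover have "\<forall>\<^sub>F x in nhds y. x \<in> {0<..<y'}"
      using y0 y' by (intro eventually_nhds_in_open) auto
    then have "\<forall>\<^sub>F x in nhds y. x \<in> UNIV \<longrightarrow> \<tau> x = G (H x)"
      by eventually_elim (use J(4)[OF y'(1)] in \<open>auto simp: \<tau>_def\<close>)
    ultimately show ?thesis
      using y by (subst has_field_derivative_cong_ev[where g="\<lambda>x. G (H x)" and y=y]) (auto simp: \<tau>_def)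
  qed
  show ?thesis
  proof (rule that[of \<tau> N])
    show "\<tau> \<in> borel_measurable borel"
    proof (rule borel_measurable_piecewise_mono[of "{?J, - ?J}"])
      show "mono_on c \<tau>" if "c \<in> {?J, - ?J}" for c
        using that strict_mono_on_imp_mono_on[OF sm] by (auto simp: \<tau>_def intro: mono_onI)
    qed (use J(6) in auto)
    show "\<tau> 0 = 0" using J(1) H(1) G(1) by (simp add: \<tau>_def)
    show "0 \<le> \<tau> y" for y using G(2) HJ by (auto simp: \<tau>_def)
    show "0 < q (\<tau> y)" if "y \<in> ?J" for y using G(2) HJ that by (auto simp: \<tau>_def)
  qed (fact sm lip N der)+
qed

text \<open>Only \<le> results, because the image of \<open>S\<close> may miss part of the
  half-line, where f \<ge> 0. The image is handled as a Lebesgue measurable set, hence the passage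
  through the completed measure.\<close>

lemma change_of_variables_le:
  fixes f g g' :: "real \<Rightarrow> real"
  assumes S: "S \<in> sets borel" and der: "\<And>x. x \<in> S \<Longrightarrow> (g has_real_derivative g' x) (at x)"
    and pos: "\<And>x. x \<in> S \<Longrightarrow> 0 \<le> g' x" and inj: "inj_on g S" and im: "g ` S \<subseteq> {0..}"
    and f: "set_integrable lborel {0..} f" "\<And>x. 0 \<le> x \<Longrightarrow> 0 \<le> f x" "f \<in> borel_measurable borel"
    and gm: "g \<in> borel_measurable borel" "g' \<in> borel_measurable borel"
  shows "set_integrable lborel S (\<lambda>x. g' x * f (g x))"
    and "(LINT x:S|lborel. g' x * f (g x)) \<le> (LINT x:{0..}|lborel. f x)"
proof -
  note [measurable] = f(3) gm S
  have SL: "S \<in> sets lebesgue" using S by (simp add: sets_completionI_sets)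
  have derS: "(g has_field_derivative g' x) (at x within S)" if "x \<in> S" for x
    using der[OF that] by (rule has_field_derivative_at_within)
  have T: "g ` S \<in> sets lebesgue"
  proof (rule differentiable_image_in_sets_lebesgue[OF SL])
    show "g differentiable_on S"
      unfolding differentiable_on_def real_differentiable_def using derS by blast
  qed simp
  have fL: "f absolutely_integrable_on {0..}"
    using f(1) unfolding set_integrable_def by (subst integrable_completion) auto
  have fT: "f absolutely_integrable_on g ` S"
    by (rule set_integrable_subset[OF fL T im])
  have cv: "(\<lambda>x. \<bar>g' x\<bar> * f (g x)) absolutely_integrable_on S \<and>
      integral S (\<lambda>x. \<bar>g' x\<bar> * f (g x)) = integral (g ` S) f"
    using has_absolute_integral_change_of_variables_1'[OF SL derS inj, of f "integral (g ` S) f"] fT by simp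
  have "set_integrable lborel S (\<lambda>x. \<bar>g' x\<bar> * f (g x))"
    using conjunct1[OF cv] unfolding set_integrable_def by (subst (asm) integrable_completion) auto
  also have "?this \<longleftrightarrow> set_integrable lborel S (\<lambda>x. g' x * f (g x))"
    using pos by (intro set_integrable_cong) auto
  finally show int: "set_integrable lborel S (\<lambda>x. g' x * f (g x))" .
  have "(LINT x:S|lborel. g' x * f (g x)) = integral S (\<lambda>x. g' x * f (g x))"
    by (rule set_borel_integral_eq_integral[OF int])
  also have "\<dots> = integral S (\<lambda>x. \<bar>g' x\<bar> * f (g x))"
    using pos by (intro integral_cong) auto
  also have "\<dots> = integral (g ` S) f" using cv by simp
  also have "\<dots> \<le> integral {0..} f"
    using fT fL f(2) by (intro integral_subset_le im) (auto simp: absolutely_integrable_on_def)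
  also have "\<dots> = (LINT x:{0..}|lborel. f x)"
    by (rule set_borel_integral_eq_integral(2)[OF f(1), symmetric])
  finally show "(LINT x:S|lborel. g' x * f (g x)) \<le> (LINT x:{0..}|lborel. f x)" .
qed

text \<open>To first order exp (\<theta> c) (1 - \<theta> + \<theta> m) is 1 + \<theta> (c + m - 1),
  and c may approach \<rho>. The summand \<open>B\<close> lets the caller shift the quotients to be
  nonnegative, since \<open>ennreal\<close> truncates.\<close>

lemma liminf_difference_quotient:
  fixes \<theta> u :: "nat \<Rightarrow> real"
  assumes \<theta>: "\<And>n. 0 < \<theta> n" "\<And>n. \<theta> n < 1" "\<theta> \<longlonglongrightarrow> 0" and m: "0 \<le> m"
    and u: "\<And>c. c < \<rho> \<Longrightarrow> \<exists>\<theta>0>0. \<forall>n. \<theta> n \<le> \<theta>0 \<longrightarrow> exp (\<theta> n * c) * (1 - \<theta> n + \<theta> n * m) \<le> u n"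
  shows "ennreal (\<rho> + m - 1 + B) \<le> liminf (\<lambda>n. ennreal ((u n - 1) / \<theta> n + B))"
proof -
  have eps: "ennreal (\<rho> + m - 1 + B - e) \<le> liminf (\<lambda>n. ennreal ((u n - 1) / \<theta> n + B))" if e: "e > 0" for e
  proof -
    \<comment> \<open>Half of e pays for choosing c below \<rho>, the other half absorbs the
      second-order term.\<close>
    define c where "c = \<rho> - e / 2"
    obtain \<theta>0 where \<theta>0: "\<theta>0 > 0" "\<And>n. \<theta> n \<le> \<theta>0 \<Longrightarrow> exp (\<theta> n * c) * (1 - \<theta> n + \<theta> n * m) \<le> u n"
      using u[of c] e unfolding c_def by auto
    have "(\<lambda>n. \<theta> n * (c * (m - 1))) \<longlonglongrightarrow> 0 * (c * (m - 1))" by (intro tendsto_mult \<theta>(3) tendsto_const)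
    then have "eventually (\<lambda>n. \<theta> n * (c * (m - 1)) > - e / 2) sequentially"
      using e by (intro order_tendstoD) auto
    moreover have "eventually (\<lambda>n. \<theta> n < \<theta>0) sequentially"
      using \<theta>0(1) \<theta>(3) by (intro order_tendstoD) auto
    ultimately have "eventually (\<lambda>n. ennreal (\<rho> + m - 1 + B - e) \<le> ennreal ((u n - 1) / \<theta> n + B)) sequentially"
    proof eventually_elim
      case (elim n)
      have p: "0 \<le> 1 - \<theta> n + \<theta> n * m" using \<theta>(1,2)[of n] m by simp
      have "\<theta> n * (c + m - 1 + \<theta> n * (c * (m - 1))) = (1 + \<theta> n * c) * (1 - \<theta> n + \<theta> n * m) - 1"
        by (simp add: algebra_simps)
      also have "(1 + \<theta> n * c) * (1 - \<theta> n + \<theta> n * m) \<le> exp (\<theta> n * c) * (1 - \<theta> n + \<theta> n * m)"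
        using exp_ge_add_one_self[of "\<theta> n * c"] p by (intro mult_right_mono) auto
      also have "\<dots> \<le> u n" using \<theta>0(2)[of n] elim by simp
      finally have "c + m - 1 + \<theta> n * (c * (m - 1)) \<le> (u n - 1) / \<theta> n"
        using \<theta>(1)[of n] by (simp add: field_simps)
      then show ?case using elim by (intro ennreal_leI) (simp add: c_def)
    qed
    then show ?thesis by (rule Liminf_bounded)
  qed
  have "(\<lambda>n. \<rho> + m - 1 + B - 1 / real (Suc n)) \<longlonglongrightarrow> \<rho> + m - 1 + B - 0"
    by (intro tendsto_diff tendsto_const LIMSEQ_Suc[OF lim_1_over_n])
  then have "(\<lambda>n. ennreal (\<rho> + m - 1 + B - 1 / real (Suc n))) \<longlonglongrightarrow> ennreal (\<rho> + m - 1 + B)"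
    by (intro tendsto_ennrealI) simp
  then show ?thesis
    by (rule LIMSEQ_le_const2) (use eps in auto)
qed

lemma difference_quotient_exp:
  fixes \<theta> :: "nat \<Rightarrow> real"
  assumes "\<And>n. 0 < \<theta> n" "\<theta> \<longlonglongrightarrow> 0"
  shows "(\<lambda>n. (exp (\<theta> n * c) - 1) / \<theta> n) \<longlonglongrightarrow> c"
proof -
  have "((\<lambda>x. exp (x * c)) has_real_derivative c) (at 0)"
    by (auto intro!: derivative_eq_intros)
  then have "((\<lambda>h. (exp (h * c) - 1) / h) \<longlongrightarrow> c) (at 0)" by (simp add: DERIV_def)
  moreover have "filterlim \<theta> (at 0) sequentially"
    using assms by (auto simp: filterlim_at less_imp_neq[symmetric])
  ultimately show ?thesis by (rule filterlim_compose)
qed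

section \<open>Integrating out one coordinate\<close>

lemma set_integrable_bounded_by:
  fixes f g :: "real \<Rightarrow> real"
  assumes "set_integrable lborel S g" "f \<in> borel_measurable borel" "S \<in> sets borel"
    "\<And>x. x \<in> S \<Longrightarrow> \<bar>f x\<bar> \<le> g x"
  shows "set_integrable lborel S f"
  unfolding set_integrable_def
  by (rule Bochner_Integration.integrable_bound[OF assms(1)[unfolded set_integrable_def]])
    (use assms in \<open>auto simp: indicator_def split: if_splits intro: order_trans[OF _ abs_ge_self]\<close>)

text \<open>
  With \<open>\<tau>\<close> the monotone transport of \<open>Q 0\<close> to \<open>exp g * W\<close>, both normalised, substitute
  \<open>(1 - \<theta>) y + \<theta> \<tau> y\<close> in the integral of \<open>Q \<theta>\<close> and let \<open>\<theta>\<close> tend to \<open>0\<close> by Fatou's lemma.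
  The limit contains \<open>\<tau>' - 1\<close> from the Jacobian and \<open>- ln \<tau>'\<close> from the transport equation,
  that is \<open>Delta \<tau>'\<close>.
\<close>

lemma marginal_step:
  fixes Q :: "real \<Rightarrow> real \<Rightarrow> real" and W \<psi> :: "real \<Rightarrow> real" and a s B B\<psi> c N0 :: real
  assumes C: "clipping_constant C" and a: "a > 0" and B: "0 \<le> B"
    and g_def: "g = (\<lambda>y. s * (1 - exp (- a * \<bar>y\<bar>)))"
    and Qm: "\<And>\<theta>. Q \<theta> \<in> borel_measurable borel" and Qpos: "\<And>\<theta> y. 0 \<le> Q \<theta> y"
    and Qa: "antimono_on {0..} (Q 0)" "antimono_on {0..} (Q 1)"
    and Qi: "\<And>\<theta>. \<theta> \<in> {0..1} \<Longrightarrow> set_integrable lborel {0..} (Q \<theta>)"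
    and logc: "\<And>y z \<sigma> r. 0 \<le> y \<Longrightarrow> 0 \<le> z \<Longrightarrow> \<sigma> \<in> {0..1} \<Longrightarrow> r \<in> {0<..1} \<Longrightarrow>
       Q 0 y powr (1 - r) * Q \<sigma> z powr r \<le> Q (r * \<sigma>) ((1 - r) * y + r * z)"
    and N0: "N0 = (LINT y:{0..}|lborel. Q 0 y)" "0 < N0"
    and Nc: "\<And>\<theta>. \<theta> \<in> {0<..1} \<Longrightarrow> (LINT y:{0..}|lborel. Q \<theta> y) \<le> N0 * exp (\<theta> * c)"
    and Wm: "W \<in> borel_measurable borel"
    and W: "\<And>y. exp (- B) * Q 1 y \<le> W y" "\<And>y. W y \<le> exp B * Q 1 y"
      "countable {y. 0 < y \<and> \<not> isCont W y}"
    and \<psi>: "\<psi> \<in> borel_measurable borel" "\<And>y. \<bar>\<psi> y\<bar> \<le> B\<psi>"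
    and tr: "\<And>y z c'. 0 \<le> y \<Longrightarrow> 0 \<le> z \<Longrightarrow> 0 < Q 0 y \<Longrightarrow>
      (\<And>\<theta>. \<theta> \<in> {0<..1} \<Longrightarrow> Q \<theta> ((1 - \<theta>) * y + \<theta> * z) \<le> Q 0 y * exp (\<theta> * c')) \<Longrightarrow>
      W z \<le> Q 0 y * exp (\<psi> y + c')"
  shows "(LINT y:{0..}|lborel. exp (g y) * W y)
    \<le> N0 * exp ((LINT y:{0..}|lborel. (\<psi> y + g y) * Q 0 y) / N0 + C * s\<^sup>2 / 4 + c)"
proof (cases "0 < (LINT y:{0..}|lborel. exp (g y) * W y)")
  case False
  then show ?thesis using N0(2) by (meson exp_gt_zero linorder_not_le mult_pos_pos order.strict_implies_order order_trans)
next
  case True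
  define K where "K = (LINT y:{0..}|lborel. exp (g y) * W y)"
  have K: "0 < K" using True by (simp add: K_def)
  have [measurable]: "g \<in> borel_measurable borel" unfolding g_def by measurable
  note [measurable] = Qm Wm \<psi>(1)
  have gb: "\<bar>g y\<bar> \<le> \<bar>s\<bar>" for y
  proof -
    have "exp (- a * \<bar>y\<bar>) \<le> 1" using a by simp
    then show ?thesis unfolding g_def abs_mult by (intro mult_left_le) auto
  qed
  have gcont: "isCont g y" for y unfolding g_def by (intro continuous_intros)
  have W0: "0 \<le> W y" for y
    by (rule order_trans[OF mult_nonneg_nonneg[OF exp_ge_zero Qpos] W(1)])
  have eg: "exp (- \<bar>s\<bar>) \<le> exp (g y)" "exp (g y) \<le> exp \<bar>s\<bar>" for y using gb[of y] by auto
  have kup: "exp (g y) * W y \<le> exp (\<bar>s\<bar> + B) * Q 1 y" for y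
    using mult_mono[OF eg(2)[of y] W(2)[of y]] W0 by (simp add: exp_add mult.assoc)
  have klow: "exp (- \<bar>s\<bar> - B) * Q 1 y \<le> exp (g y) * W y" for y
    using mult_mono[OF eg(1)[of y] W(1)[of y]] Qpos by (simp add: exp_diff exp_minus divide_inverse mult.assoc)
  \<comment> \<open>\<open>h\<close> and \<open>k\<close> are the normalised source and target
    densities. The tilt can destroy monotonicity of \<open>k\<close>; \<open>q\<close> is the
    nonincreasing minorant that the lower bound of \<open>W\<close> by \<open>Q 1\<close>
    provides.\<close>
  define h where "h y = Q 0 y / N0" for y
  define k where "k y = exp (g y) * W y / K" for y
  define q where "q y = exp (- \<bar>s\<bar> - B) * Q 1 y / K" for y
  have [measurable]: "h \<in> borel_measurable borel" "k \<in> borel_measurable borel"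
    unfolding h_def[abs_def] k_def[abs_def] by measurable
  have h: "\<And>x. x \<ge> 0 \<Longrightarrow> h x \<ge> 0" "antimono_on {0..} h" "set_integrable lborel {0..} h"
      "(LINT x:{0..}|lborel. h x) = 1"
    using Qpos N0 Qi[of 0] monotone_onD[OF Qa(1)] unfolding h_def
    by (auto simp: intro!: monotone_onI divide_right_mono)
  have k: "set_integrable lborel {0..} k" "\<And>y. 0 \<le> y \<Longrightarrow> 0 \<le> k y"
      "\<And>y. 0 \<le> y \<Longrightarrow> k y \<le> exp (\<bar>s\<bar> + B) * Q 1 0 / K"
      "(LINT x:{0..}|lborel. k x) = 1" "countable {y. 0 < y \<and> \<not> isCont k y}"
  proof -
    have "set_integrable lborel {0..} (\<lambda>y. exp (\<bar>s\<bar> + B) * Q 1 y)" using Qi[of 1] by simp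
    then have "set_integrable lborel {0..} (\<lambda>y. exp (g y) * W y)"
      by (rule set_integrable_bounded_by) (use kup W0 in auto)
    then show "set_integrable lborel {0..} k" "(LINT x:{0..}|lborel. k x) = 1"
      using K unfolding k_def by (auto simp: K_def)
    show "0 \<le> k y" for y using W0[of y] K by (simp add: k_def)
    show "k y \<le> exp (\<bar>s\<bar> + B) * Q 1 0 / K" if "0 \<le> y" for y
      unfolding k_def using K monotone_onD[OF Qa(2), of 0 y] that
      by (intro divide_right_mono order_trans[OF kup]) auto
    have "isCont k y" if "isCont W y" for y
      unfolding k_def using that K by (intro continuous_intros gcont) auto
    then have "{y. 0 < y \<and> \<not> isCont k y} \<subseteq> {y. 0 < y \<and> \<not> isCont W y}" by auto
    then show "countable {y. 0 < y \<and> \<not> isCont k y}" using W(3) by (rule countable_subset)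
  qed
  have q: "antimono_on {0..} q" "\<And>y. 0 \<le> y \<Longrightarrow> q y \<le> k y" "\<And>y. 0 \<le> y \<Longrightarrow> 0 \<le> q y"
      "\<And>y. 0 \<le> y \<Longrightarrow> q y = 0 \<Longrightarrow> k y = 0"
  proof -
    show "antimono_on {0..} q"
      using K monotone_onD[OF Qa(2)] by (auto intro!: monotone_onI divide_right_mono simp: q_def)
    show "q y \<le> k y" for y unfolding q_def k_def using K klow[of y] by (intro divide_right_mono) auto
    show "0 \<le> q y" for y using K Qpos by (simp add: q_def)
    show "k y = 0" if "q y = 0" for y
      using kup[of y] W0[of y] K that by (auto simp: q_def k_def mult_le_0_iff)
  qed
  obtain \<tau> N where [measurable]: "\<tau> \<in> borel_measurable borel" and \<tau>: "\<And>y. 0 \<le> \<tau> y" "\<tau> 0 = 0"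
    "strict_mono_on (before_end h) \<tau>"
    "\<And>b. b \<in> before_end h \<Longrightarrow> \<exists>L. L-lipschitz_on {0..b} \<tau>"
    and N: "countable N" "\<And>y. y \<in> before_end h - N \<Longrightarrow> (\<tau> has_real_derivative h y / k (\<tau> y)) (at y)"
    and q\<tau>: "\<And>y. y \<in> before_end h \<Longrightarrow> 0 < q (\<tau> y)"
    by (rule monotone_transport[OF h k q]) blast+
  have h': "\<forall>x\<ge>0. h x \<ge> 0" using h(1) by blast
  note J = before_end_props[OF h' h(2,4)]
  define m where "m y = h y / k (\<tau> y)" for y
  have [measurable]: "m \<in> borel_measurable borel" unfolding m_def[abs_def] by measurable
  define P where "P = density lborel (\<lambda>y. ennreal (h y * indicator {0..} y))"
  have [measurable_cong]: "sets P = sets borel" by (simp add: P_def)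
  have h1: "(\<integral>\<^sup>+x\<in>{0..}. ennreal (h x) \<partial>lborel) = 1"
  proof -
    have "(\<integral>\<^sup>+x\<in>{0..}. ennreal (h x) \<partial>lborel) = (\<integral>\<^sup>+x. ennreal (indicator {0..} x *\<^sub>R h x) \<partial>lborel)"
      by (intro nn_integral_cong) (simp split: split_indicator)
    also have "\<dots> = ennreal (LINT x:{0..}|lborel. h x)"
      unfolding set_lebesgue_integral_def using h(1,3)
      by (intro nn_integral_eq_integral) (auto simp: set_integrable_def indicator_def)
    finally show ?thesis using h(4) by simp
  qed
  have ind: "ennreal (h y * indicator {0..} y) = ennreal (h y) * indicator {0..} y" for y
    by (simp split: split_indicator)
  interpret P: prob_space P
    by standard (use h1 in \<open>simp add: P_def emeasure_density ind\<close>)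
  have PE: "(LINT y|P. f y) = (LINT y:{0..}|lborel. f y * Q 0 y) / N0"
    if "f \<in> borel_measurable borel" for f :: "real \<Rightarrow> real"
  proof -
    have "(LINT y|P. f y) = (LINT y|lborel. (h y * indicator {0..} y) *\<^sub>R f y)"
      unfolding P_def using that h(1) by (intro integral_density) (auto split: split_indicator)
    also have "\<dots> = (LINT y|lborel. (indicator {0..} y *\<^sub>R (f y * Q 0 y)) / N0)"
      by (intro Bochner_Integration.integral_cong) (auto simp: h_def split: split_indicator)
    finally show ?thesis by (simp add: set_lebesgue_integral_def)
  qed
  have PJ: "AE y in P. y \<in> before_end h"
    unfolding P_def
    by (subst AE_density, measurable, use J(5) in eventually_elim) (auto split: split_indicator_asm simp: indicator_def)
  \<comment> \<open>A set of full measure for \<open>P\<close> on which the transport is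
    differentiable with positive derivative.\<close>
  define S where "S = before_end h - N"
  have [measurable]: "S \<in> sets borel" unfolding S_def by (rule sets.Diff[OF J(6) sets.countable[OF _ N(1)]]) simp
  have PN: "AE y in P. y \<notin> N"
    unfolding P_def using AE_not_in[OF countable_imp_null_set_lborel[OF N(1)]] 
    by (subst AE_density) auto
  have PS: "AE y in P. y \<in> S" using PJ PN by eventually_elim (simp add: S_def)
  have pos: "0 < Q 0 y" "0 < k (\<tau> y)" "0 < Q 1 (\<tau> y)" "0 < W (\<tau> y)" "0 < m y" "0 \<le> y" if "y \<in> S" for y
  proof -
    have yJ: "y \<in> before_end h" using that by (simp add: S_def)
    show "0 < Q 0 y" using J(7)[OF yJ] N0 by (simp add: h_def zero_less_divide_iff)
    show 1: "0 < k (\<tau> y)" using q\<tau>[OF yJ] q(2)[OF \<tau>(1)[of y]] by simp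
    show "0 < Q 1 (\<tau> y)" using q\<tau>[OF yJ] K by (simp add: q_def zero_less_divide_iff zero_less_mult_iff)
    show "0 < W (\<tau> y)" using 1 K by (simp add: k_def zero_less_divide_iff zero_less_mult_iff)
    show "0 < m y" using 1 J(7)[OF yJ] by (simp add: m_def)
    show "0 \<le> y" using yJ J(2) by auto
  qed
  \<comment> \<open>The shift by two makes already the first value strictly less than 1.\<close>
  define \<theta> :: "nat \<Rightarrow> real" where "\<theta> n = 1 / real (Suc (Suc n))" for n
  have \<theta>: "\<And>n. 0 < \<theta> n" "\<And>n. \<theta> n < 1" "\<theta> \<longlonglongrightarrow> 0"
    unfolding \<theta>_def using LIMSEQ_Suc[OF LIMSEQ_Suc[OF lim_1_over_n]] by auto
  define z where "z n y = (1 - \<theta> n) * y + \<theta> n * \<tau> y" for n y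
  define z' where "z' n y = 1 - \<theta> n + \<theta> n * m y" for n y
  have [measurable]: "z n \<in> borel_measurable borel" "z' n \<in> borel_measurable borel" for n
    unfolding z_def[abs_def] z'_def[abs_def] by measurable
  have z'pos: "0 \<le> z' n y" if "y \<in> S" for n y
    using \<theta>(1,2)[of n] pos(5)[OF that] by (simp add: z'_def)
  \<comment> \<open>The integrand of \<open>Q (\<theta> n)\<close> after the substitution by
    \<open>z n\<close>, relative to the source density; its mean over \<open>S\<close> under
    \<open>P\<close> is therefore at most exp (\<theta> c).\<close>
  define u where "u n y = z' n y * Q (\<theta> n) (z n y) / Q 0 y" for n y
  have [measurable]: "u n \<in> borel_measurable borel" for n unfolding u_def[abs_def] by measurable
  have u0: "0 \<le> u n y" if "y \<in> S" for n y
    using z'pos[OF that] Qpos by (simp add: u_def)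
  have uint: "(\<integral>\<^sup>+y. ennreal (u n y) * indicator S y \<partial>P) \<le> ennreal (exp (\<theta> n * c))" for n
  proof -
    have inj: "inj_on (z n) S"
    proof (rule strict_mono_on_imp_inj_on, rule strict_mono_onI)
      fix x y assume "x \<in> S" "y \<in> S" "x < y"
      then have "\<tau> x < \<tau> y" using strict_mono_onD[OF \<tau>(3), of x y] by (simp add: S_def)
      then show "z n x < z n y" unfolding z_def using \<open>x < y\<close> \<theta>(1,2)[of n]
        by (intro add_strict_mono mult_strict_left_mono) auto
    qed
    have der: "(z n has_real_derivative z' n y) (at y)" if "y \<in> S" for y
    proof -
      have "(\<tau> has_real_derivative m y) (at y)" using N(2) that by (simp add: S_def m_def)
      then show ?thesis unfolding z_def z'_def by (auto intro!: derivative_eq_intros)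
    qed
    have im: "z n ` S \<subseteq> {0..}" using pos(6) \<tau>(1) \<theta>(1,2)[of n] by (auto simp: z_def intro!: add_nonneg_nonneg)
    have \<theta>01: "\<theta> n \<in> {0..1}" "\<theta> n \<in> {0<..1}" using \<theta>(1,2)[of n] by auto
    have sS: "S \<in> sets borel" by measurable
    note cv = change_of_variables_le[OF sS der z'pos inj im Qi[OF \<theta>01(1)] Qpos Qm]
    have cv1: "set_integrable lborel S (\<lambda>x. z' n x * Q (\<theta> n) (z n x))"
      and cv2: "(LINT x:S|lborel. z' n x * Q (\<theta> n) (z n x)) \<le> (LINT x:{0..}|lborel. Q (\<theta> n) x)"
      by (rule cv; simp)+
    have "(\<integral>\<^sup>+y. ennreal (u n y) * indicator S y \<partial>P)
        = (\<integral>\<^sup>+y. ennreal (indicator S y * (z' n y * Q (\<theta> n) (z n y)) / N0) \<partial>lborel)"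
      unfolding P_def
    proof (subst nn_integral_density, measurable, rule nn_integral_cong)
      fix y
      show "ennreal (h y * indicator {0..} y) * (ennreal (u n y) * indicator S y)
          = ennreal (indicator S y * (z' n y * Q (\<theta> n) (z n y)) / N0)"
      proof (cases "y \<in> S")
        case True
        have "h y * u n y = z' n y * Q (\<theta> n) (z n y) / N0"
          using pos(1)[OF True] by (simp add: u_def h_def)
        then show ?thesis using True pos(6)[OF True] u0[OF True] h(1)[of y]
          by (simp add: ennreal_mult[symmetric])
      qed simp
    qed
    also have "\<dots> = ennreal (LINT y|lborel. indicator S y * (z' n y * Q (\<theta> n) (z n y)) / N0)"
      using cv1 z'pos Qpos N0(2) unfolding set_integrable_def
      by (intro nn_integral_eq_integral) (auto simp: indicator_def)
    also have "\<dots> \<le> ennreal (exp (\<theta> n * c))"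
    proof (rule ennreal_leI)
      have "(LINT y|lborel. indicator S y * (z' n y * Q (\<theta> n) (z n y)) / N0)
          = (LINT x:S|lborel. z' n x * Q (\<theta> n) (z n x)) / N0"
        by (simp add: set_lebesgue_integral_def)
      also have "\<dots> \<le> N0 * exp (\<theta> n * c) / N0"
        using cv2 Nc[OF \<theta>01(2)] N0(2) by (intro divide_right_mono) auto
      finally show "(LINT y|lborel. indicator S y * (z' n y * Q (\<theta> n) (z n y)) / N0) \<le> exp (\<theta> n * c)"
        using N0(2) by simp
    qed
    finally show ?thesis .
  qed
  \<comment> \<open>The quantity to be bounded: the logarithm of the ratio of target mass to source
    mass.\<close>
  define L where "L = ln (K / N0)"
  have eL: "exp L = K / N0" using K N0 by (simp add: L_def)
  define D where "D = \<bar>L\<bar> + \<bar>s\<bar> + B + B\<psi>"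
  have B\<psi>: "0 \<le> B\<psi>" using \<psi>(2)[of 0] by linarith
  have D0: "0 \<le> D" using B B\<psi> by (simp add: D_def)
  \<comment> \<open>The lower bound, uniform in n, that Fatou's lemma asks for. Log-concavity gives
    Q \<theta> \<ge> Q 0^(1-\<theta>) Q 1^\<theta>, the arithmetic-geometric mean inequality gives
    \<open>z'\<close> \<ge> m^\<theta>, and together u \<ge> r^\<theta>. The transport equation
    expresses r by L, g and the ratio of \<open>Q 1\<close> to \<open>W\<close>, all bounded, whence
    \<open>D\<close>.\<close>
  have ulow: "- D \<le> (u n y - 1) / \<theta> n" if y: "y \<in> S" for n y
  proof -
    define r where "r = Q 1 (\<tau> y) * m y / Q 0 y"
    have r: "r = Q 1 (\<tau> y) / (exp (g (\<tau> y)) * W (\<tau> y)) * exp L"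
      using pos[OF y] K N0 unfolding r_def m_def h_def k_def eL by (simp add: field_simps)
    have "exp (- D) \<le> r"
    proof -
      have "exp (- D) \<le> exp (- (\<bar>s\<bar> + B)) * exp L"
        unfolding exp_add[symmetric] using B\<psi> by (simp add: D_def)
      also have "exp (- (\<bar>s\<bar> + B)) \<le> Q 1 (\<tau> y) / (exp (g (\<tau> y)) * W (\<tau> y))"
      proof -
        have "exp (- (\<bar>s\<bar> + B)) * (exp (g (\<tau> y)) * W (\<tau> y))
            \<le> exp (- (\<bar>s\<bar> + B)) * (exp (\<bar>s\<bar> + B) * Q 1 (\<tau> y))"
          by (intro mult_left_mono kup) simp
        also have "\<dots> = Q 1 (\<tau> y)" unfolding mult.assoc[symmetric] exp_add[symmetric] by simp
        finally show ?thesis using pos[OF y] by (simp add: pos_le_divide_eq)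
      qed
      finally show ?thesis unfolding r by simp
    qed
    then have "exp (- D) powr \<theta> n \<le> r powr \<theta> n" using \<theta>(1)[of n] by (intro powr_mono2) auto
    also have "\<dots> = (Q 0 y powr (1 - \<theta> n) * Q 1 (\<tau> y) powr \<theta> n) * m y powr \<theta> n / Q 0 y"
      using pos[OF y] by (simp add: r_def powr_divide powr_mult powr_diff)
    also have "\<dots> \<le> Q (\<theta> n) (z n y) * z' n y / Q 0 y"
    proof (intro divide_right_mono mult_mono)
      show "Q 0 y powr (1 - \<theta> n) * Q 1 (\<tau> y) powr \<theta> n \<le> Q (\<theta> n) (z n y)"
        using logc[of y "\<tau> y" 1 "\<theta> n"] \<theta>(1,2)[of n] pos(6)[OF y] \<tau>(1)[of y] by (simp add: z_def less_imp_le)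
      show "m y powr \<theta> n \<le> z' n y"
        using Youngs_inequality_0[of "1 - \<theta> n" "\<theta> n" 1 "m y"] \<theta>(1,2)[of n] pos(5)[OF y]
        by (simp add: z'_def less_imp_le)
    qed (use Qpos in auto)
    finally have "exp (- D * \<theta> n) \<le> u n y" by (simp add: u_def powr_def mult.commute)
    then have "1 + - D * \<theta> n \<le> u n y" using exp_ge_add_one_self[of "- D * \<theta> n"] by linarith
    then show ?thesis using \<theta>(1)[of n] by (simp add: field_simps)
  qed
  \<comment> \<open>The slope at which the conclusion of \<open>tr\<close> is an equality; any
    smaller slope must be exceeded somewhere on the segment.\<close>
  define \<rho> where "\<rho> y = ln (W (\<tau> y) / Q 0 y) - \<psi> y" for y
  have ulim: "ennreal (\<rho> y + m y - 1 + D) \<le> liminf (\<lambda>n. ennreal ((u n y - 1) / \<theta> n + D))" if y: "y \<in> S" for y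
  proof (rule liminf_difference_quotient[OF \<theta> less_imp_le[OF pos(5)[OF y]]])
    fix c' assume c': "c' < \<rho> y"
    have "\<not> W (\<tau> y) \<le> Q 0 y * exp (\<psi> y + c')"
    proof
      assume "W (\<tau> y) \<le> Q 0 y * exp (\<psi> y + c')"
      then have "W (\<tau> y) / Q 0 y \<le> exp (\<psi> y + c')" using pos[OF y] by (simp add: field_simps)
      then have "ln (W (\<tau> y) / Q 0 y) \<le> \<psi> y + c'"
        using pos[OF y] by (metis divide_pos_pos ln_exp ln_le_cancel_iff exp_gt_zero)
      then show False using c' by (simp add: \<rho>_def)
    qed
    \<comment> \<open>\<open>tr\<close> read backwards: its conclusion fails for c', so its slope
      hypothesis fails at some \<theta>0.\<close>
    then obtain \<theta>0 where \<theta>0: "\<theta>0 \<in> {0<..1}" "Q 0 y * exp (\<theta>0 * c') < Q \<theta>0 ((1 - \<theta>0) * y + \<theta>0 * \<tau> y)"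
      using tr[of y "\<tau> y" c'] pos[OF y] \<tau>(1)[of y] by (meson not_le)
    show "\<exists>\<theta>0>0. \<forall>n. \<theta> n \<le> \<theta>0 \<longrightarrow> exp (\<theta> n * c') * (1 - \<theta> n + \<theta> n * m y) \<le> u n y"
    proof (intro exI[of _ \<theta>0] conjI allI impI)
      fix n assume n: "\<theta> n \<le> \<theta>0"
      \<comment> \<open>Log-concavity on the segment from y to the point at \<theta>0 carries the
        excess over to every smaller \<theta>; r is the fraction of that segment.\<close>
      define r where "r = \<theta> n / \<theta>0"
      have r: "r \<in> {0<..1}" "r * \<theta>0 = \<theta> n" using n \<theta>0 \<theta>(1)[of n] by (auto simp: r_def)
      let ?w = "(1 - \<theta>0) * y + \<theta>0 * \<tau> y"
      have "Q 0 y * exp (\<theta> n * c') = Q 0 y powr (1 - r) * (Q 0 y * exp (\<theta>0 * c')) powr r"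
        using pos[OF y] r by (simp add: powr_mult powr_diff) (simp add: powr_def mult.assoc[symmetric])
      also have "\<dots> \<le> Q 0 y powr (1 - r) * Q \<theta>0 ?w powr r"
        using \<theta>0(2) r pos[OF y] by (intro mult_left_mono powr_mono2) auto
      also have "\<dots> \<le> Q (r * \<theta>0) ((1 - r) * y + r * ?w)"
        using \<theta>0(1) r(1) pos(6)[OF y] \<tau>(1)[of y] by (intro logc) (auto intro!: add_nonneg_nonneg)
      also have "(1 - r) * y + r * ?w = (1 - r * \<theta>0) * y + (r * \<theta>0) * \<tau> y" by (simp add: algebra_simps)
      finally have "Q 0 y * exp (\<theta> n * c') \<le> Q (\<theta> n) (z n y)" by (simp add: r(2) z_def)
      then have "exp (\<theta> n * c') \<le> Q (\<theta> n) (z n y) / Q 0 y" using pos[OF y] by (simp add: field_simps)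
      then show "exp (\<theta> n * c') * (1 - \<theta> n + \<theta> n * m y) \<le> u n y"
        using mult_right_mono[OF _ z'pos[OF y, of n]] by (fastforce simp: u_def z'_def mult.commute)
    qed (use \<theta>0 in auto)
  qed
  have mix: "(\<integral>\<^sup>+y. ennreal ((u n y - 1) / \<theta> n + D) * indicator S y \<partial>P)
      \<le> ennreal ((exp (\<theta> n * c) - 1) / \<theta> n + D)" and mixpos: "0 \<le> (exp (\<theta> n * c) - 1) / \<theta> n + D" for n
  proof -
    define U where "U y = u n y * indicator S y" for y
    have Um[measurable]: "U \<in> borel_measurable borel" unfolding U_def by measurable
    have U0: "0 \<le> U y" for y using u0 by (simp add: U_def split: split_indicator)
    have Unn: "(\<integral>\<^sup>+y. ennreal (U y) \<partial>P) \<le> ennreal (exp (\<theta> n * c))"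
    proof -
      have "(\<integral>\<^sup>+y. ennreal (U y) \<partial>P) = (\<integral>\<^sup>+y. ennreal (u n y) * indicator S y \<partial>P)"
        by (intro nn_integral_cong) (simp add: U_def split: split_indicator)
      then show ?thesis using uint[of n] by simp
    qed
    have Ui: "integrable P U"
      using Unn U0 by (intro integrableI_nonneg) (auto simp: less_top[symmetric] top_unique)
    have UE: "(LINT y|P. U y) \<le> exp (\<theta> n * c)"
      using Unn nn_integral_eq_integral[OF Ui] U0 by (simp add: ennreal_le_iff)
    have AEpos: "AE y in P. 0 \<le> (U y - 1) / \<theta> n + D"
      using PS by eventually_elim (use ulow[of _ n] in \<open>fastforce simp: U_def\<close>)
    have Vi: "integrable P (\<lambda>y. (U y - 1) / \<theta> n + D)"
      using Ui by (intro Bochner_Integration.integrable_add integrable_divide_zero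
          Bochner_Integration.integrable_diff P.integrable_const) auto
    have VE: "(LINT y|P. (U y - 1) / \<theta> n + D) \<le> (exp (\<theta> n * c) - 1) / \<theta> n + D"
    proof -
      have "(LINT y|P. (U y - 1) / \<theta> n + D) = ((LINT y|P. U y) - 1) / \<theta> n + D"
        using Ui by (simp add: P.prob_space)
      also have "\<dots> \<le> (exp (\<theta> n * c) - 1) / \<theta> n + D"
        using UE \<theta>(1)[of n] by (intro add_right_mono divide_right_mono) auto
      finally show ?thesis .
    qed
    have "0 \<le> (LINT y|P. (U y - 1) / \<theta> n + D)" using AEpos by (rule integral_nonneg_AE)
    then show "0 \<le> (exp (\<theta> n * c) - 1) / \<theta> n + D" using VE by linarith
    have "(\<integral>\<^sup>+y. ennreal ((u n y - 1) / \<theta> n + D) * indicator S y \<partial>P)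
        \<le> (\<integral>\<^sup>+y. ennreal ((U y - 1) / \<theta> n + D) \<partial>P)"
      by (intro nn_integral_mono) (simp add: U_def split: split_indicator)
    also have "\<dots> = ennreal (LINT y|P. (U y - 1) / \<theta> n + D)"
      using Vi AEpos by (rule nn_integral_eq_integral)
    also have "\<dots> \<le> ennreal ((exp (\<theta> n * c) - 1) / \<theta> n + D)" using VE by (rule ennreal_leI)
    finally show "(\<integral>\<^sup>+y. ennreal ((u n y - 1) / \<theta> n + D) * indicator S y \<partial>P)
      \<le> ennreal ((exp (\<theta> n * c) - 1) / \<theta> n + D)" .
  qed
  have lim: "(\<lambda>n. (exp (\<theta> n * c) - 1) / \<theta> n + D) \<longlonglongrightarrow> c + D"
    by (intro tendsto_add difference_quotient_exp \<theta> tendsto_const)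
  have cD: "0 \<le> c + D" by (rule LIMSEQ_le_const[OF lim]) (use mixpos in auto)
  have fatou: "(\<integral>\<^sup>+y. ennreal (\<rho> y + m y - 1 + D) \<partial>P) \<le> ennreal (c + D)"
  proof -
    have "(\<integral>\<^sup>+y. ennreal (\<rho> y + m y - 1 + D) \<partial>P)
        \<le> (\<integral>\<^sup>+y. liminf (\<lambda>n. ennreal ((u n y - 1) / \<theta> n + D) * indicator S y) \<partial>P)"
    proof (rule nn_integral_mono_AE)
      show "AE y in P. ennreal (\<rho> y + m y - 1 + D) \<le> liminf (\<lambda>n. ennreal ((u n y - 1) / \<theta> n + D) * indicator S y)"
        using PS by eventually_elim (use ulim in simp)
    qed
    also have "\<dots> \<le> liminf (\<lambda>n. \<integral>\<^sup>+y. ennreal ((u n y - 1) / \<theta> n + D) * indicator S y \<partial>P)"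
      by (intro nn_integral_liminf) measurable
    also have "\<dots> \<le> liminf (\<lambda>n. ennreal ((exp (\<theta> n * c) - 1) / \<theta> n + D))"
      by (intro Liminf_mono always_eventually allI mix)
    also have "\<dots> = ennreal (c + D)"
      by (intro lim_imp_Liminf tendsto_ennrealI lim) simp
    finally show ?thesis .
  qed
  \<comment> \<open>What remains of the limit once \<open>Delta (m y)\<close> is split off; the
    shift by \<open>D\<close> makes it nonnegative.\<close>
  define v where "v y = L - g (\<tau> y) - \<psi> y + D" for y
  have [measurable]: "v \<in> borel_measurable borel" unfolding v_def by measurable
  have vb: "0 \<le> v y" "\<bar>v y\<bar> \<le> 2 * D" for y
    using gb[of "\<tau> y"] \<psi>(2)[of y] B unfolding v_def D_def by (auto simp: abs_le_iff)
  have vi: "integrable P v" using vb(2) by (intro P.integrable_const_bound[where B="2 * D"]) auto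
  have split: "AE y in P. ennreal (\<rho> y + m y - 1 + D) = Delta (m y) + ennreal (v y)"
    using PS
  proof eventually_elim
    case (elim y)
    \<comment> \<open>The transport equation solved for the ratio; its factor 1/m supplies the
      logarithm in \<open>Delta\<close>.\<close>
    have "W (\<tau> y) / Q 0 y = exp L * exp (- g (\<tau> y)) / m y"
      using pos[OF elim] K N0 unfolding m_def h_def k_def eL by (simp add: field_simps exp_minus)
    then have "ln (W (\<tau> y) / Q 0 y) = L - g (\<tau> y) - ln (m y)"
      using pos(5)[OF elim] by (simp add: ln_div ln_mult)
    then have "\<rho> y + m y - 1 + D = (m y - 1 - ln (m y)) + v y" by (simp add: \<rho>_def v_def)
    then have "ennreal (\<rho> y + m y - 1 + D) = ennreal ((m y - 1 - ln (m y)) + v y)" by (simp only:)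
    moreover have "0 \<le> m y - 1 - ln (m y)" using ln_le_minus_one[OF pos(5)[OF elim]] by simp
    ultimately show ?case using pos(5)[OF elim] vb(1)[of y] by (simp add: Delta_def ennreal_plus)
  qed
  have tot: "(\<integral>\<^sup>+y. Delta (m y) \<partial>P) + ennreal (LINT y|P. v y) \<le> ennreal (c + D)"
  proof -
    have "(\<integral>\<^sup>+y. Delta (m y) \<partial>P) + ennreal (LINT y|P. v y) = (\<integral>\<^sup>+y. Delta (m y) + ennreal (v y) \<partial>P)"
      using vi vb(1) by (subst nn_integral_add) (auto simp: nn_integral_eq_integral)
    also have "\<dots> = (\<integral>\<^sup>+y. ennreal (\<rho> y + m y - 1 + D) \<partial>P)"
      by (rule nn_integral_cong_AE) (use split in eventually_elim, simp)
    finally show ?thesis using fatou by simp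
  qed
  define A where "A = enn2real (\<integral>\<^sup>+y. Delta (m y) \<partial>P)"
  have fin: "(\<integral>\<^sup>+y. Delta (m y) \<partial>P) = ennreal A" and A0: "0 \<le> A"
  proof -
    have "(\<integral>\<^sup>+y. Delta (m y) \<partial>P) \<le> ennreal (c + D)"
      using add_increasing2[OF zero_le order_refl] tot by (rule order_trans)
    then have "(\<integral>\<^sup>+y. Delta (m y) \<partial>P) < top" by (rule le_less_trans) simp
    then show "(\<integral>\<^sup>+y. Delta (m y) \<partial>P) = ennreal A"
      unfolding A_def by simp
  qed (simp add: A_def)
  have vE: "0 \<le> (LINT y|P. v y)" using vb(1) by simp
  have Av: "A + (LINT y|P. v y) \<le> c + D"
    using tot cD A0 vE unfolding fin by (simp flip: ennreal_plus)
  have bnd: "integrable P f" if "f \<in> borel_measurable borel" "\<And>y. \<bar>f y\<bar> \<le> b" for f :: "real \<Rightarrow> real" and b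
    using that by (intro P.integrable_const_bound[where B=b]) auto
  have gi: "integrable P g" "integrable P (\<lambda>y. g (\<tau> y))" "integrable P \<psi>"
    by (rule bnd[OF _ gb] bnd[OF _ \<psi>(2)]; measurable)+
  have "(LINT y|P. v y) = L - (LINT y|P. g (\<tau> y)) - (LINT y|P. \<psi> y) + D"
    unfolding v_def using gi by (simp add: P.prob_space)
  \<comment> \<open>The shift \<open>D\<close> drops out and the cost \<open>A\<close> appears with
    a minus sign. The clipping estimate below bounds the mean of g(\<tau>) - g by A + C s^2/4, so
    \<open>A\<close> cancels.\<close>
  then have 1: "L \<le> c + (LINT y|P. g (\<tau> y)) + (LINT y|P. \<psi> y) - A" using Av by simp
  have "(LINT y|P. s * ((1 - exp (- a * \<tau> y)) - (1 - exp (- a * y)))) \<le> A + C * s\<^sup>2 / 4"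
    unfolding P_def
  proof (rule exp_transport_bound[OF C a h(1,2) h1 _ J(1-4)])
    show "AE y in density lborel (\<lambda>y. ennreal (h y * indicator {0..} y)). y \<in> before_end h"
      using PJ unfolding P_def .
    show "mono_on (before_end h) \<tau>" using \<tau>(3) by (rule strict_mono_on_imp_mono_on)
    show "(\<tau> has_real_derivative m y) (at y)" if "y \<in> before_end h - N" for y
      using N(2)[OF that] by (simp add: m_def)
    show "(\<integral>\<^sup>+y. Delta (m y) \<partial>density lborel (\<lambda>y. ennreal (h y * indicator {0..} y))) \<le> ennreal A"
      using fin unfolding P_def by simp
  qed (use \<tau> N A0 in \<open>auto\<close>)
  also have "(LINT y|P. s * ((1 - exp (- a * \<tau> y)) - (1 - exp (- a * y)))) = (LINT y|P. g (\<tau> y) - g y)"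
  proof (rule integral_cong_AE)
    show "AE y in P. s * ((1 - exp (- a * \<tau> y)) - (1 - exp (- a * y))) = g (\<tau> y) - g y"
      using PS by eventually_elim (use pos(6) \<tau>(1) in \<open>simp add: g_def right_diff_distrib\<close>)
  qed measurable
  also have "\<dots> = (LINT y|P. g (\<tau> y)) - (LINT y|P. g y)" using gi by simp
  finally have "L \<le> (LINT y|P. \<psi> y) + (LINT y|P. g y) + C * s\<^sup>2 / 4 + c" using 1 by simp
  also have "(LINT y|P. \<psi> y) + (LINT y|P. g y) = (LINT y|P. \<psi> y + g y)" using gi by simp
  also have "\<dots> = (LINT y:{0..}|lborel. (\<psi> y + g y) * Q 0 y) / N0" by (rule PE) measurable
  finally have "exp L \<le> exp ((LINT y:{0..}|lborel. (\<psi> y + g y) * Q 0 y) / N0 + C * s\<^sup>2 / 4 + c)" by simp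
  then show ?thesis unfolding eL K_def[symmetric] using N0(2) by (simp add: field_simps)
qed

section \<open>Window masses of an unconditional log-concave law\<close>

definition flip :: "'n \<Rightarrow> real ^ 'n \<Rightarrow> real ^ 'n" where
  "flip i z = (\<chi> j. if j = i then - z $ j else z $ j)"

definition upd :: "real ^ 'n \<Rightarrow> 'n \<Rightarrow> real \<Rightarrow> real ^ 'n" where
  "upd x i y = (\<chi> j. if j = i then y else x $ j)"

definition window :: "real \<Rightarrow> 'n set \<Rightarrow> real ^ 'n \<Rightarrow> (real ^ 'n) set" where
  "window \<delta> A x = {z. \<forall>j. j \<notin> A \<longrightarrow> \<bar>z $ j - x $ j\<bar> \<le> \<delta>}"

text \<open>The convolution of \<phi> with the uniform density on [-\<delta>, \<delta>]. It appears
  when a window indicator, weighted by \<phi> of the centre, is integrated over one coordinate of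
  the centre.\<close>

definition window_average :: "real \<Rightarrow> (real \<Rightarrow> real) \<Rightarrow> real \<Rightarrow> real" where
  "window_average \<delta> \<phi> z = (LINT y|lborel. indicator {z - \<delta>..z + \<delta>} y * \<phi> y) / (2 * \<delta>)"

lemma closed_window: "closed (window \<delta> A x)"
proof -
  have "window \<delta> A x = (\<Inter>j\<in>-A. {z. \<bar>z $ j - x $ j\<bar> \<le> \<delta>})" by (auto simp: window_def)
  then show ?thesis by (auto intro!: closed_INT closed_Collect_le continuous_intros)
qed

lemma window_borel [measurable]: "window \<delta> A x \<in> sets borel"
  using closed_window by (rule borel_closed)

text \<open>Closeness of z_i and y is read as a constraint on y for given z, which prepares Fubini's
  theorem.\<close>

lemma indicator_window_upd:
  assumes "i \<notin> A"
  shows "indicator (window \<delta> A (upd x i y)) z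
    = (indicator (window \<delta> (insert i A) x) z * indicator {z $ i - \<delta>..z $ i + \<delta>} y :: real)"
  using assms by (auto simp: window_def upd_def indicator_def abs_le_iff)

text \<open>All windows have the same half-width, so convex combinations respect them. This turns
  Borell's inequality for sets into log-concavity in the centre.\<close>

lemma window_mix:
  assumes "u \<in> window \<delta> A x" "w \<in> window \<delta> A x'" "r \<in> {0..1}"
  shows "(1 - r) *\<^sub>R u + r *\<^sub>R w \<in> window \<delta> A ((1 - r) *\<^sub>R x + r *\<^sub>R x')"
  unfolding window_def
proof (intro CollectI allI impI)
  fix j assume "j \<notin> A"
  then have "\<bar>u $ j - x $ j\<bar> \<le> \<delta>" "\<bar>w $ j - x' $ j\<bar> \<le> \<delta>" using assms by (auto simp: window_def)
  then have "\<bar>(1 - r) * (u $ j - x $ j)\<bar> \<le> (1 - r) * \<delta>" "\<bar>r * (w $ j - x' $ j)\<bar> \<le> r * \<delta>"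
    using assms(3) by (auto simp: abs_mult intro: mult_left_mono)
  then have "\<bar>(1 - r) * (u $ j - x $ j) + r * (w $ j - x' $ j)\<bar> \<le> (1 - r) * \<delta> + r * \<delta>"
    by linarith
  then show "\<bar>((1 - r) *\<^sub>R u + r *\<^sub>R w) $ j - ((1 - r) *\<^sub>R x + r *\<^sub>R x') $ j\<bar> \<le> \<delta>"
    by (simp add: algebra_simps)
qed

lemma upd_mix:
  "(1 - r) *\<^sub>R upd x i y + r *\<^sub>R upd x' i z = upd ((1 - r) *\<^sub>R x + r *\<^sub>R x') i ((1 - r) * y + r * z)"
  by (simp add: upd_def vec_eq_iff)

lemma window_average_measurable [measurable]:
  assumes [measurable]: "\<phi> \<in> borel_measurable borel"
  shows "window_average \<delta> \<phi> \<in> borel_measurable borel"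
proof -
  have [measurable]: "Measurable.pred (borel \<Otimes>\<^sub>M borel) (\<lambda>p::real \<times> real. snd p \<in> {fst p - \<delta>..fst p + \<delta>})"
    unfolding atLeastAtMost_iff by measurable
  show ?thesis
    unfolding window_average_def[abs_def] indicator_def by measurable
qed

lemma integrable_indicator_Icc: "integrable lborel (\<lambda>y. indicator {u..w :: real} y * (c :: real))"
  by (intro integrable_mult_left integrable_real_indicator) (auto simp: emeasure_lborel_Icc_eq)

lemma integrable_window:
  fixes \<phi> :: "real \<Rightarrow> real"
  assumes "\<phi> \<in> borel_measurable borel" "\<And>y. \<bar>\<phi> y\<bar> \<le> c"
  shows "integrable lborel (\<lambda>y. indicator {u..w} y * \<phi> y)"
proof (rule Bochner_Integration.integrable_bound)
  show "integrable lborel (\<lambda>y. indicator {u..w} y * c)" by (rule integrable_indicator_Icc)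
qed (use assms in \<open>auto simp: indicator_def intro: order_trans[OF _ abs_ge_self]\<close>)

lemma window_average_bounds:
  fixes \<phi> :: "real \<Rightarrow> real"
  assumes \<delta>: "0 < \<delta>" and [measurable]: "\<phi> \<in> borel_measurable borel"
    and b: "\<And>y. y \<in> {z - \<delta>..z + \<delta>} \<Longrightarrow> l \<le> \<phi> y" "\<And>y. y \<in> {z - \<delta>..z + \<delta>} \<Longrightarrow> \<phi> y \<le> b"
  shows "l \<le> window_average \<delta> \<phi> z" "window_average \<delta> \<phi> z \<le> b"
proof -
  have c: "(LINT y|lborel. indicator {z - \<delta>..z + \<delta>} y * c) = 2 * \<delta> * c" for c :: real
    using \<delta> by simp
  define c where "c = max \<bar>l\<bar> \<bar>b\<bar>"
  have int: "integrable lborel (\<lambda>y. indicator {z - \<delta>..z + \<delta>} y * \<phi> y)"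
  proof (rule Bochner_Integration.integrable_bound[OF integrable_indicator_Icc])
    show "AE y in lborel. norm (indicator {z - \<delta>..z + \<delta>} y * \<phi> y) \<le> norm (indicator {z - \<delta>..z + \<delta>} y * c)"
      using b by (intro AE_I2) (force simp: indicator_def c_def)
  qed measurable
  have "2 * \<delta> * l \<le> (LINT y|lborel. indicator {z - \<delta>..z + \<delta>} y * \<phi> y)"
    unfolding c[symmetric] using b by (intro integral_mono int integrable_indicator_Icc) (auto simp: indicator_def)
  moreover have "(LINT y|lborel. indicator {z - \<delta>..z + \<delta>} y * \<phi> y) \<le> 2 * \<delta> * b"
    unfolding c[symmetric] using b by (intro integral_mono int integrable_indicator_Icc) (auto simp: indicator_def)
  ultimately show "l \<le> window_average \<delta> \<phi> z" "window_average \<delta> \<phi> z \<le> b"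
    using \<delta> by (auto simp: window_average_def field_simps)
qed

lemma window_average_even:
  assumes "\<And>y. \<phi> (- y) = \<phi> y"
  shows "window_average \<delta> \<phi> (- z) = window_average \<delta> \<phi> z"
proof -
  have "(LINT y|lborel. indicator {- z - \<delta>..- z + \<delta>} y * \<phi> y)
      = (LINT y|lborel. indicator {- z - \<delta>..- z + \<delta>} (- y) * \<phi> (- y))"
    using lborel_integral_real_affine[of "-1" _ 0] by simp
  also have "\<dots> = (LINT y|lborel. indicator {z - \<delta>..z + \<delta>} y * \<phi> y)"
    using assms by (intro Bochner_Integration.integral_cong) (auto simp: indicator_def)
  finally show ?thesis by (simp add: window_average_def)
qed

lemma flip_measurable [measurable]:
  fixes i :: "'n :: finite"
  shows "flip i \<in> borel \<rightarrow>\<^sub>M borel"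
proof -
  have "continuous_on UNIV (\<lambda>x::real^'n. if j = i then - x $ j else x $ j)" for j :: 'n
    by (cases "j = i") (auto intro!: continuous_intros)
  then have "continuous_on UNIV (flip i)"
    unfolding flip_def[abs_def] by (rule continuous_on_vec_lambda)
  then show ?thesis by (rule borel_measurable_continuous_onI)
qed

text \<open>Symmetry is recorded through single reflections, as coordinates are treated one at a
  time.\<close>

locale unconditional_log_concave = prob_space \<nu> for \<nu> :: "(real ^ 'n) measure" +
  fixes \<delta> :: real
  assumes sets_\<nu> [measurable_cong]: "sets \<nu> = sets borel"
    and flip_invariant: "\<And>i. distr \<nu> borel (flip i) = \<nu>"
    and log_concave: "log_concave_measure \<nu>"
    and \<delta>: "0 < \<delta>"
begin

text \<open>Left unnormalised, so that slicing acts linearly and windows of mass 0 are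
  harmless.\<close>

definition wint :: "'n set \<Rightarrow> (real ^ 'n \<Rightarrow> real) \<Rightarrow> real ^ 'n \<Rightarrow> real" where
  "wint A f x = (LINT z|\<nu>. indicator (window \<delta> A x) z * f z)"

abbreviation q :: "'n set \<Rightarrow> real ^ 'n \<Rightarrow> real" where
  "q A \<equiv> wint A (\<lambda>_. 1)"

lemma q_measure: "q A x = prob (window \<delta> A x)"
  by (simp add: wint_def sets_\<nu>)

lemma wint_integrable:
  fixes b :: real and f :: "real ^ 'n \<Rightarrow> real"
  assumes [measurable]: "f \<in> borel_measurable borel" and b: "\<And>z. \<bar>f z\<bar> \<le> b"
  shows "integrable \<nu> (\<lambda>z. indicator (window \<delta> A x) z * f z)"
proof (rule integrable_const_bound[where B=b])
  have "0 \<le> b" using b[of 0] by linarith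
  then show "AE z in \<nu>. norm (indicator (window \<delta> A x) z * f z) \<le> b"
    using b by (auto simp: indicator_def)
qed measurable

lemma wint_bounds:
  fixes l b :: real
  assumes [measurable]: "f \<in> borel_measurable borel" and b: "\<And>z. l \<le> f z" "\<And>z. f z \<le> b"
  shows "l * q A x \<le> wint A f x" "wint A f x \<le> b * q A x"
proof -
  have int: "integrable \<nu> (\<lambda>z. indicator (window \<delta> A x) z * f z)"
  proof (rule wint_integrable)
    show "\<bar>f z\<bar> \<le> max \<bar>l\<bar> \<bar>b\<bar>" for z using b[of z] by linarith
  qed measurable
  have c: "c * q A x = (LINT z|\<nu>. indicator (window \<delta> A x) z * c)" for c
    unfolding wint_def by (subst integral_mult_right_zero[symmetric]) (simp add: mult.commute)
  have ci: "integrable \<nu> (\<lambda>z. indicator (window \<delta> A x) z * c)" for c :: real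
    by (rule wint_integrable[of "\<lambda>_. c" "\<bar>c\<bar>"]) auto
  show "l * q A x \<le> wint A f x"
    unfolding c unfolding wint_def using b by (intro integral_mono int ci) (auto simp: indicator_def)
  show "wint A f x \<le> b * q A x"
    unfolding c unfolding wint_def using b by (intro integral_mono int ci) (auto simp: indicator_def)
qed

text \<open>The reflection preserves \<open>\<nu>\<close> and exchanges the windows centred at - y
  and at y.\<close>

lemma wint_upd_even:
  assumes f[measurable]: "f \<in> borel_measurable borel" and inv: "\<And>z. f (flip i z) = f z"
  shows "wint A f (upd x i (- y)) = wint A f (upd x i y)"
proof -
  have "wint A f (upd x i (- y)) = (LINT z|distr \<nu> borel (flip i). indicator (window \<delta> A (upd x i (- y))) z * f z)"
    by (simp add: wint_def flip_invariant)
  also have "\<dots> = (LINT z|\<nu>. indicator (window \<delta> A (upd x i (- y))) (flip i z) * f (flip i z))"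
    by (rule integral_distr) measurable
  also have "\<dots> = wint A f (upd x i y)"
    unfolding wint_def inv
    by (intro Bochner_Integration.integral_cong refl)
       (auto simp: indicator_def window_def upd_def flip_def abs_minus_commute split: if_splits)
  finally show ?thesis .
qed

text \<open>Fubini's theorem: for fixed z the centre y runs over an interval of length 2\<delta>
  around z_i, so the inner integral is 2\<delta> times a window average. This is how a marginal is
  taken without densities.\<close>

lemma wint_slice:
  assumes i: "i \<notin> A" and [measurable]: "f \<in> borel_measurable borel" "\<phi> \<in> borel_measurable borel"
    and fb: "\<And>z. \<bar>f z\<bar> \<le> b" and \<phi>b: "\<And>y. \<bar>\<phi> y\<bar> \<le> c"
  shows "integrable lborel (\<lambda>y. \<phi> y * wint A f (upd x i y))"
    and "(LINT y|lborel. \<phi> y * wint A f (upd x i y))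
      = 2 * \<delta> * wint (insert i A) (\<lambda>z. f z * window_average \<delta> \<phi> (z $ i)) x"
proof -
  interpret L: pair_sigma_finite \<nu> lborel ..
  define F where "F z y = indicator (window \<delta> (insert i A) x) z * f z * (indicator {z $ i - \<delta>..z $ i + \<delta>} y * \<phi> y)" for z y
  have [measurable]: "(\<lambda>p::(real^'n) \<times> real. fst p $ i) \<in> borel_measurable (borel \<Otimes>\<^sub>M borel)"
    by (rule measurable_compose[OF measurable_fst borel_measurable_nth])
  have [measurable]: "Measurable.pred (borel \<Otimes>\<^sub>M borel) (\<lambda>p::(real^'n) \<times> real. snd p \<in> {fst p $ i - \<delta>..fst p $ i + \<delta>})"
    unfolding atLeastAtMost_iff by measurable
  have Fm[measurable]: "(\<lambda>(z, y). F z y) \<in> borel_measurable (\<nu> \<Otimes>\<^sub>M lborel)"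
    unfolding F_def indicator_def[of "{_.._}"] by measurable
  have b0: "0 \<le> b" "0 \<le> c" using fb[of 0] \<phi>b[of 0] by linarith+
  have Fi: "integrable lborel (\<lambda>y. F z y)" for z
    unfolding F_def by (intro integrable_mult_right integrable_window[OF _ \<phi>b]) measurable
  have FE: "(LINT y|lborel. F z y) = 2 * \<delta> * (indicator (window \<delta> (insert i A) x) z * (f z * window_average \<delta> \<phi> (z $ i)))" for z
    using \<delta> by (simp add: F_def window_average_def)
  have int: "integrable (\<nu> \<Otimes>\<^sub>M lborel) (\<lambda>(z, y). F z y)"
  proof (rule L.Fubini_integrable)
    have bd: "(LINT y|lborel. norm (F z y)) \<le> b * c * (2 * \<delta>)" for z
    proof -
      have "(LINT y|lborel. norm (F z y)) \<le> (LINT y|lborel. indicator {z $ i - \<delta>..z $ i + \<delta>} y * (b * c))"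
      proof (intro integral_mono integrable_norm Fi integrable_indicator_Icc)
        show "norm (F z y) \<le> indicator {z $ i - \<delta>..z $ i + \<delta>} y * (b * c)" for y
          using mult_mono[OF fb[of z] \<phi>b[of y]] b0 by (auto simp: F_def indicator_def abs_mult)
      qed
      also have "\<dots> = b * c * (2 * \<delta>)" using \<delta> by simp
      finally show ?thesis .
    qed
    show "integrable \<nu> (\<lambda>z. LINT y|lborel. norm (case (z, y) of (z, y) \<Rightarrow> F z y))"
      by (rule integrable_const_bound[where B="b * c * (2 * \<delta>)"]) (use bd in auto)
    show "AE z in \<nu>. integrable lborel (\<lambda>y. case (z, y) of (z, y) \<Rightarrow> F z y)" using Fi by simp
  qed measurable
  have slice: "\<phi> y * wint A f (upd x i y) = (LINT z|\<nu>. F z y)" for y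
    unfolding wint_def integral_mult_right_zero[symmetric]
    by (intro Bochner_Integration.integral_cong refl) (simp add: F_def indicator_window_upd[OF i])
  show "integrable lborel (\<lambda>y. \<phi> y * wint A f (upd x i y))"
    unfolding slice using L.integrable_snd[OF int] .
  have "(LINT y|lborel. \<phi> y * wint A f (upd x i y)) = (LINT z|\<nu>. LINT y|lborel. F z y)"
    unfolding slice using L.Fubini_integral[OF int] .
  then show "(LINT y|lborel. \<phi> y * wint A f (upd x i y))
      = 2 * \<delta> * wint (insert i A) (\<lambda>z. f z * window_average \<delta> \<phi> (z $ i)) x"
    unfolding FE by (simp add: wint_def)
qed

lemma wint_upd_measurable:
  assumes "i \<notin> A" "f \<in> borel_measurable borel" "\<And>z. \<bar>f z\<bar> \<le> b"
  shows "(\<lambda>y. wint A f (upd x i y)) \<in> borel_measurable borel"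
  using borel_measurable_integrable[OF wint_slice(1)[OF assms(1,2) _ assms(3), of "\<lambda>_. 1" 1 x]] by simp

text \<open>The slice is even in y, so the half-line carries half of the factor 2\<delta>.\<close>

lemma wint_half_slice:
  assumes i: "i \<notin> A" and m: "f \<in> borel_measurable borel" "\<phi> \<in> borel_measurable borel"
    and fb: "\<And>z. \<bar>f z\<bar> \<le> b" and \<phi>b: "\<And>y. \<bar>\<phi> y\<bar> \<le> c"
    and inv: "\<And>z. f (flip i z) = f z" and even: "\<And>y. \<phi> (- y) = \<phi> y"
  shows "set_integrable lborel {0..} (\<lambda>y. \<phi> y * wint A f (upd x i y))"
    and "(LINT y:{0..}|lborel. \<phi> y * wint A f (upd x i y))
      = \<delta> * wint (insert i A) (\<lambda>z. f z * window_average \<delta> \<phi> (z $ i)) x"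
proof -
  note S = wint_slice[OF i m fb \<phi>b, of x]
  show si: "set_integrable lborel {0..} (\<lambda>y. \<phi> y * wint A f (upd x i y))"
    unfolding set_integrable_def by (rule integrable_mult_indicator[OF _ S(1)]) simp
  have "has_bochner_integral lborel (\<lambda>y. \<phi> y * wint A f (upd x i y))
      (2 *\<^sub>R (LINT y:{0..}|lborel. \<phi> y * wint A f (upd x i y)))"
  proof (rule has_bochner_integral_even_function)
    show "has_bochner_integral lborel (\<lambda>y. indicator {0..} y *\<^sub>R (\<phi> y * wint A f (upd x i y)))
       (LINT y:{0..}|lborel. \<phi> y * wint A f (upd x i y))"
      using si unfolding set_integrable_def set_lebesgue_integral_def by (rule has_bochner_integral_integrable)
    show "\<phi> (- y) * wint A f (upd x i (- y)) = \<phi> y * wint A f (upd x i y)" for y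
      using wint_upd_even[OF m(1) inv] even by simp
  qed
  then show "(LINT y:{0..}|lborel. \<phi> y * wint A f (upd x i y))
      = \<delta> * wint (insert i A) (\<lambda>z. f z * window_average \<delta> \<phi> (z $ i)) x"
    using S(2) by (simp add: has_bochner_integral_iff)
qed

text \<open>Windows are unbounded in the coordinates of \<open>A\<close>, whereas Borell's
  inequality speaks of compact sets; so they are cut off by balls of radius n, and n tends to
  infinity.\<close>

lemma q_log_concave:
  assumes r: "r \<in> {0..1}"
  shows "q A x powr (1 - r) * q A x' powr r \<le> q A ((1 - r) *\<^sub>R x + r *\<^sub>R x')"
proof (cases "q A x = 0 \<or> q A x' = 0")
  \<comment> \<open>A vanishing mass makes the left side 0, even for exponent 0 because
    \<open>0 powr 0 = 0\<close>. Nonzero limits are what continuity of \<open>powr\<close> asks for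
    in the other case.\<close>
  case True
  then show ?thesis by (auto simp: q_measure)
next
  case False
  define V where "V x n = window \<delta> A x \<inter> cball 0 (real n)" for x and n :: nat
  have [measurable]: "V x n \<in> sets \<nu>" for x n unfolding V_def sets_\<nu> by measurable
  have inc: "incseq (V x)" for x
    unfolding V_def by (intro monoI) auto
  have "(\<Union>n. V x n) = window \<delta> A x" for x
    unfolding V_def using real_arch_simple by auto
  then have lim: "(\<lambda>n. prob (V x n)) \<longlonglongrightarrow> q A x" for x
    using finite_Lim_measure_incseq[OF _ inc[of x]] by (simp add: q_measure image_subset_iff)
  have "(\<lambda>n. prob (V x n) powr (1 - r) * prob (V x' n) powr r) \<longlonglongrightarrow> q A x powr (1 - r) * q A x' powr r"
    using False by (intro tendsto_mult tendsto_powr lim tendsto_const) auto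
  moreover have "prob (V x n) powr (1 - r) * prob (V x' n) powr r \<le> q A ((1 - r) *\<^sub>R x + r *\<^sub>R x')" for n
  proof (cases "V x n = {} \<or> V x' n = {}")
    case True
    then show ?thesis by (auto simp: q_measure)
  next
    case nonempty: False
    have comp: "compact (V x n)" for x
      unfolding V_def using closed_window by (rule closed_Int_compact) simp
    have "prob (V x' n) powr r * prob (V x n) powr (1 - r)
        \<le> prob {r *\<^sub>R u + (1 - r) *\<^sub>R w | u w. u \<in> V x' n \<and> w \<in> V x n}"
      using log_concave r comp nonempty unfolding log_concave_measure_def by blast
    also have "\<dots> \<le> prob (window \<delta> A ((1 - r) *\<^sub>R x + r *\<^sub>R x'))"
    proof (rule finite_measure_mono)
      show "{r *\<^sub>R u + (1 - r) *\<^sub>R w | u w. u \<in> V x' n \<and> w \<in> V x n} \<subseteq> window \<delta> A ((1 - r) *\<^sub>R x + r *\<^sub>R x')"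
        using window_mix[OF _ _ r, of _ \<delta> A x _ x'] by (auto simp: V_def add.commute)
    qed (simp add: sets_\<nu>)
    finally show ?thesis by (simp add: q_measure mult.commute)
  qed
  ultimately show ?thesis by (intro LIMSEQ_le_const2) auto
qed

text \<open>A point of [0, y'] is a convex combination of - y' and y', where the masses agree by
  symmetry, so log-concavity bounds its mass below by their common value.\<close>

lemma q_upd_antimono: "antimono_on {0..} (\<lambda>y. q A (upd x i y))"
proof (rule monotone_onI)
  fix y y' :: real assume y: "y \<in> {0..}" "y' \<in> {0..}" "y \<le> y'"
  show "q A (upd x i y) \<ge> q A (upd x i y')"
  proof (cases "y' = 0")
    case True
    then show ?thesis using y by simp
  next
    case False
    define r where "r = (1 + y / y') / 2"
    have r: "r \<in> {0..1}" using y False by (auto simp: r_def field_simps)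
    have "(1 - r) * (- y') + r * y' = y" using y False by (simp add: r_def field_simps)
    then have mix: "(1 - r) *\<^sub>R upd x i (- y') + r *\<^sub>R upd x i y' = upd x i y"
      by (simp add: upd_mix scaleR_left_distrib[symmetric])
    have "q A (upd x i (- y')) = q A (upd x i y')" by (rule wint_upd_even) auto
    then have "q A (upd x i y') powr (1 - r) * q A (upd x i y') powr r \<le> q A (upd x i y)"
      using q_log_concave[OF r, of A "upd x i (- y')" "upd x i y'"] mix by simp
    moreover have "q A (upd x i y') powr (1 - r) * q A (upd x i y') powr r = q A (upd x i y')"
      by (simp add: powr_add[symmetric] q_measure)
    ultimately show ?thesis by simp
  qed
qed

text \<open>As the window slides along coordinate i, the integral is a difference of two cumulative
  functions, each monotone because f \<ge> 0. Windows are closed, hence \<le> at the right edge and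
  < at the left.\<close>

lemma wint_upd_discontinuities:
  assumes i: "i \<notin> A" and m[measurable]: "f \<in> borel_measurable borel" and b: "\<And>z. 0 \<le> f z" "\<And>z. f z \<le> b"
  shows "countable {y. \<not> isCont (\<lambda>y. wint A f (upd x i y)) y}"
proof -
  define F where "F z = indicator (window \<delta> (insert i A) x) z * f z" for z
  have [measurable]: "F \<in> borel_measurable borel" unfolding F_def by measurable
  have F0: "0 \<le> F z" "F z \<le> b" for z using b[of z] by (auto simp: F_def indicator_def)
  have b0: "0 \<le> b" using b[of 0] by linarith
  define G1 where "G1 u = (LINT z|\<nu>. F z * indicator {z. z $ i \<le> u} z)" for u
  define G2 where "G2 u = (LINT z|\<nu>. F z * indicator {z. z $ i < u} z)" for u
  have int1: "integrable \<nu> (\<lambda>z. F z * indicator {z. z $ i \<le> u} z)" for u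
    using F0 b0 by (intro integrable_const_bound[where B=b]) (auto simp: indicator_def)
  have int2: "integrable \<nu> (\<lambda>z. F z * indicator {z. z $ i < u} z)" for u
    using F0 b0 by (intro integrable_const_bound[where B=b]) (auto simp: indicator_def)
  have "mono G1" unfolding G1_def
    by (intro monoI integral_mono int1) (auto simp: indicator_def F0)
  then have c1: "countable {u. \<not> isCont G1 u}" by (rule mono_ctble_discont)
  have "mono G2" unfolding G2_def
    by (intro monoI integral_mono int2) (auto simp: indicator_def F0)
  then have c2: "countable {u. \<not> isCont G2 u}" by (rule mono_ctble_discont)
  have eq: "wint A f (upd x i y) = G1 (y + \<delta>) - G2 (y - \<delta>)" for y
  proof -
    have "wint A f (upd x i y) = (LINT z|\<nu>. F z * indicator {z. z $ i \<le> y + \<delta>} z - F z * indicator {z. z $ i < y - \<delta>} z)"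
      unfolding wint_def F_def indicator_window_upd[OF i] using \<delta>
      by (intro Bochner_Integration.integral_cong refl) (auto simp: indicator_def)
    then show ?thesis unfolding G1_def G2_def using int1 int2 by simp
  qed
  have "{y. \<not> isCont (\<lambda>y. wint A f (upd x i y)) y}
      \<subseteq> (\<lambda>u. u - \<delta>) ` {u. \<not> isCont G1 u} \<union> (\<lambda>u. u + \<delta>) ` {u. \<not> isCont G2 u}"
  proof (rule subsetI, rule ccontr)
    fix y assume y: "y \<in> {y. \<not> isCont (\<lambda>y. wint A f (upd x i y)) y}"
      "y \<notin> (\<lambda>u. u - \<delta>) ` {u. \<not> isCont G1 u} \<union> (\<lambda>u. u + \<delta>) ` {u. \<not> isCont G2 u}"
    have "isCont G1 (y + \<delta>)" using y(2) by (force simp: image_iff)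
    moreover have "isCont G2 (y - \<delta>)" using y(2) by (force simp: image_iff)
    ultimately have "isCont (\<lambda>y. G1 (y + \<delta>) - G2 (y - \<delta>)) y"
      by (intro continuous_diff isCont_o2[where f="\<lambda>y. y + \<delta>" and g=G1]
          isCont_o2[where f="\<lambda>y. y - \<delta>" and g=G2] continuous_intros)
    then show False using y(1) by (simp add: eq)
  qed
  then show ?thesis by (rule countable_subset) (use c1 c2 in auto)
qed

end

section \<open>Comparison along all coordinates\<close>

locale tilted_windows = unconditional_log_concave \<nu> \<delta> for \<nu> :: "(real ^ 'n) measure" and \<delta> :: real +
  fixes C :: real and a s :: "'n \<Rightarrow> real"
  assumes C: "clipping_constant C" and a: "\<And>i. 0 < a i"
begin

definition g :: "'n \<Rightarrow> real \<Rightarrow> real" where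
  "g i y = s i * (1 - exp (- a i * \<bar>y\<bar>))"

text \<open>Slicing produces window averages of \<open>exp (g i y)\<close> and of
  \<open>g i y\<close> in place of point values.\<close>

definition tilt :: "'n \<Rightarrow> real \<Rightarrow> real" where
  "tilt i = window_average \<delta> (\<lambda>y. exp (g i y))"

definition mean :: "'n \<Rightarrow> real \<Rightarrow> real" where
  "mean i = window_average \<delta> (g i)"

text \<open>Interpolates between the plain window mass for empty \<open>A\<close> and, for
  \<open>A = UNIV\<close>, the exponential moment with every factor smoothed.\<close>

definition W :: "'n set \<Rightarrow> real ^ 'n \<Rightarrow> real" where
  "W A = wint A (\<lambda>z. \<Prod>j\<in>A. tilt j (z $ j))"

text \<open>Divided by \<open>q A x\<close>, this is the window mean of the exponent gathered so
  far, with a share C s_j^2/4 for each coordinate integrated out.\<close>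

definition \<Psi> :: "'n set \<Rightarrow> real ^ 'n \<Rightarrow> real" where
  "\<Psi> A = wint A (\<lambda>z. \<Sum>j\<in>A. mean j (z $ j) + C * (s j)\<^sup>2 / 4)"

section \<open>Bounds for the smoothed tilts and means\<close>

lemma C_pos: "0 < C" using C by (simp add: clipping_constant_def)

lemma g_measurable [measurable]: "g i \<in> borel_measurable borel"
  unfolding g_def[abs_def] by measurable

lemma g_bound: "\<bar>g i y\<bar> \<le> \<bar>s i\<bar>"
proof -
  have "exp (- a i * \<bar>y\<bar>) \<le> 1" using a[of i] by simp
  then show ?thesis unfolding g_def abs_mult by (intro mult_left_le) auto
qed

lemma g_even: "g i (- y) = g i y" by (simp add: g_def)

lemma tilt_measurable [measurable]: "tilt i \<in> borel_measurable borel"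
  unfolding tilt_def by measurable

lemma mean_measurable [measurable]: "mean i \<in> borel_measurable borel"
  unfolding mean_def by measurable

lemma tilt_bounds: "exp (- \<bar>s i\<bar>) \<le> tilt i z" "tilt i z \<le> exp \<bar>s i\<bar>"
  unfolding tilt_def using g_bound[of i]
  by (auto intro!: window_average_bounds[OF \<delta>] simp: abs_le_iff minus_le_iff)

lemma mean_bounds: "\<bar>mean i z\<bar> \<le> \<bar>s i\<bar>"
proof -
  have "- \<bar>s i\<bar> \<le> mean i z" "mean i z \<le> \<bar>s i\<bar>"
    unfolding mean_def using g_bound[of i]
    by (auto intro!: window_average_bounds[OF \<delta>] simp: abs_le_iff minus_le_iff)
  then show ?thesis by (simp add: abs_le_iff)
qed

lemma prod_tilt_bounds:
  "exp (- (\<Sum>i\<in>UNIV. \<bar>s i\<bar>)) \<le> (\<Prod>j\<in>A. tilt j (z $ j))"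
  "(\<Prod>j\<in>A. tilt j (z $ j)) \<le> exp (\<Sum>i\<in>UNIV. \<bar>s i\<bar>)"
proof -
  have S: "(\<Sum>i\<in>A. \<bar>s i\<bar>) \<le> (\<Sum>i\<in>UNIV. \<bar>s i\<bar>)" by (rule sum_mono2) auto
  have "exp (- (\<Sum>i\<in>UNIV. \<bar>s i\<bar>)) \<le> exp (\<Sum>i\<in>A. - \<bar>s i\<bar>)" using S by (simp add: sum_negf)
  also have "\<dots> = (\<Prod>i\<in>A. exp (- \<bar>s i\<bar>))" by (rule exp_sum) simp
  also have "\<dots> \<le> (\<Prod>j\<in>A. tilt j (z $ j))" by (intro prod_mono conjI tilt_bounds) simp
  finally show "exp (- (\<Sum>i\<in>UNIV. \<bar>s i\<bar>)) \<le> (\<Prod>j\<in>A. tilt j (z $ j))" .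
  have "(\<Prod>j\<in>A. tilt j (z $ j)) \<le> (\<Prod>i\<in>A. exp \<bar>s i\<bar>)"
    by (intro prod_mono conjI tilt_bounds order_trans[OF exp_ge_zero tilt_bounds(1)])
  also have "\<dots> = exp (\<Sum>i\<in>A. \<bar>s i\<bar>)" by (rule exp_sum[symmetric]) simp
  also have "\<dots> \<le> exp (\<Sum>i\<in>UNIV. \<bar>s i\<bar>)" using S by simp
  finally show "(\<Prod>j\<in>A. tilt j (z $ j)) \<le> exp (\<Sum>i\<in>UNIV. \<bar>s i\<bar>)" .
qed

lemma sum_mean_bound:
  "\<bar>\<Sum>j\<in>A. mean j (z $ j) + C * (s j)\<^sup>2 / 4\<bar> \<le> (\<Sum>i\<in>UNIV. \<bar>s i\<bar> + C * (s i)\<^sup>2 / 4)"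
proof -
  have "\<bar>\<Sum>j\<in>A. mean j (z $ j) + C * (s j)\<^sup>2 / 4\<bar> \<le> (\<Sum>j\<in>A. \<bar>mean j (z $ j) + C * (s j)\<^sup>2 / 4\<bar>)"
    by (rule sum_abs)
  also have "\<dots> \<le> (\<Sum>j\<in>A. \<bar>s j\<bar> + C * (s j)\<^sup>2 / 4)"
    using C_pos by (intro sum_mono order_trans[OF abs_triangle_ineq] add_mono mean_bounds) simp
  also have "\<dots> \<le> (\<Sum>i\<in>UNIV. \<bar>s i\<bar> + C * (s i)\<^sup>2 / 4)"
    using C_pos by (intro sum_mono2) auto
  finally show ?thesis .
qed

text \<open>
  The slope \<open>c\<close> plays the role of the directional derivative of \<open>ln (q A)\<close>
  at \<open>x\<close> towards \<open>x'\<close>, so no differentiability is needed.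
\<close>

lemma window_comparison:
  fixes A :: "'n set"
  assumes "0 < q A x" "\<And>\<theta>. \<theta> \<in> {0<..1} \<Longrightarrow> q A ((1 - \<theta>) *\<^sub>R x + \<theta> *\<^sub>R x') \<le> q A x * exp (\<theta> * c)"
  shows "W A x' \<le> q A x * exp (\<Psi> A x / q A x + c)"
  using finite[of A] assms
proof (induction A arbitrary: x x' c)
  case empty
  \<comment> \<open>With no coordinate free, \<open>W\<close> is the mass itself and \<Psi> = 0, so
    the claim is the slope bound at \<theta> = 1.\<close>
  then show ?case using empty(2)[of 1] by (simp add: W_def \<Psi>_def wint_def)
next
  case (insert i A)
  let ?p = "\<lambda>z::real^'n. \<Prod>j\<in>A. tilt j (z $ j)"
  let ?m = "\<lambda>z::real^'n. \<Sum>j\<in>A. mean j (z $ j) + C * (s j)\<^sup>2 / 4"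
  define B where "B = (\<Sum>i\<in>UNIV. \<bar>s i\<bar>)"
  define B' where "B' = (\<Sum>i\<in>UNIV. \<bar>s i\<bar> + C * (s i)\<^sup>2 / 4)"
  have i: "i \<notin> A" by fact
  have pm[measurable]: "?p \<in> borel_measurable borel" and mm[measurable]: "?m \<in> borel_measurable borel"
    by measurable
  have pb: "\<bar>?p z\<bar> \<le> exp B" for z
    using prod_tilt_bounds[where A=A and z=z] order_trans[OF exp_ge_zero prod_tilt_bounds(1)[where A=A and z=z]]
    unfolding B_def by (simp add: abs_of_nonneg)
  have mb: "\<bar>?m z\<bar> \<le> B'" for z unfolding B'_def by (rule sum_mean_bound)
  have B0: "0 \<le> B" unfolding B_def by (rule sum_nonneg) simp
  have pe: "?p (flip i z) = ?p z" and me: "?m (flip i z) = ?m z" for z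
    using i by (auto intro!: prod.cong sum.cong simp: flip_def)
  have one: "window_average \<delta> (\<lambda>_. 1) z = 1" for z
    using window_average_bounds[OF \<delta>, of "\<lambda>_. 1" z 1 1] by auto
  define N0 where "N0 = \<delta> * q (insert i A) x"
  \<comment> \<open>Slices in coordinate i along the segment from x to x'. They integrate to
    \<delta> times the mass for \<open>insert i A\<close>, so the slope hypothesis for that set is
    the mass bound of the one-dimensional step.\<close>
  define Q where "Q \<theta> y = q A (upd ((1 - \<theta>) *\<^sub>R x + \<theta> *\<^sub>R x') i y)" for \<theta> y
  \<comment> \<open>Where the slice has no mass the quotient is 0 by convention; \<Psi> vanishes
    there too, so multiplying back by the mass recovers \<Psi> everywhere.\<close>
  define \<psi> where "\<psi> y = \<Psi> A (upd x i y) / q A (upd x i y)" for y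
  have Q01: "Q 0 = (\<lambda>y. q A (upd x i y))" "Q 1 = (\<lambda>y. q A (upd x' i y))" by (auto simp: Q_def)
  have qm: "(\<lambda>y. q A (upd u i y)) \<in> borel_measurable borel" for u
    by (rule wint_upd_measurable[OF i, of _ 1]) auto
  have qi: "set_integrable lborel {0..} (\<lambda>y. q A (upd u i y))"
    and qI: "(LINT y:{0..}|lborel. q A (upd u i y)) = \<delta> * q (insert i A) u" for u
  proof -
    have "set_integrable lborel {0..} (\<lambda>y. 1 * q A (upd u i y))"
      by (rule wint_half_slice(1)[OF i, where b=1 and c=1]) auto
    then show "set_integrable lborel {0..} (\<lambda>y. q A (upd u i y))" by simp
    have "(LINT y:{0..}|lborel. 1 * q A (upd u i y))
        = \<delta> * wint (insert i A) (\<lambda>z. 1 * window_average \<delta> (\<lambda>_. 1) (z $ i)) u"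
      by (rule wint_half_slice(2)[OF i, where b=1 and c=1]) auto
    then show "(LINT y:{0..}|lborel. q A (upd u i y)) = \<delta> * q (insert i A) u" by (simp add: one)
  qed
  have \<Psi>m: "(\<lambda>y. \<Psi> A (upd u i y)) \<in> borel_measurable borel" for u
    unfolding \<Psi>_def by (rule wint_upd_measurable[OF i mm mb])
  have \<Psi>b: "\<bar>\<Psi> A u\<bar> \<le> B' * q A u" for u
    unfolding \<Psi>_def using wint_bounds[of ?m "- B'" B' A u] mb by (auto simp: abs_le_iff minus_le_iff)
  have qpos: "0 \<le> q A u" for A u by (simp add: q_measure)
  have "(LINT y:{0..}|lborel. exp (g i y) * W A (upd x' i y))
    \<le> N0 * exp ((LINT y:{0..}|lborel. (\<psi> y + g i y) * Q 0 y) / N0 + C * (s i)\<^sup>2 / 4 + c)"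
  proof (rule marginal_step[OF C a B0 _ _ _ _ _ _ _ _ _ _ _ _ _ _ _ _ _])
    show "g i = (\<lambda>y. s i * (1 - exp (- a i * \<bar>y\<bar>)))" by (simp add: g_def[abs_def])
    show "Q \<theta> \<in> borel_measurable borel" for \<theta> unfolding Q_def by (rule qm)
    show "0 \<le> Q \<theta> y" for \<theta> y by (simp add: Q_def qpos)
    show "antimono_on {0..} (Q 0)" "antimono_on {0..} (Q 1)" unfolding Q01 by (rule q_upd_antimono)+
    show "set_integrable lborel {0..} (Q \<theta>)" for \<theta> unfolding Q_def by (rule qi)
    show "Q 0 y powr (1 - r) * Q \<sigma> z powr r \<le> Q (r * \<sigma>) ((1 - r) * y + r * z)"
      if "r \<in> {0<..1}" for y z \<sigma> r
    proof -
      have "(1 - r) *\<^sub>R x + r *\<^sub>R ((1 - \<sigma>) *\<^sub>R x + \<sigma> *\<^sub>R x') = (1 - r * \<sigma>) *\<^sub>R x + (r * \<sigma>) *\<^sub>R x'"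
        by (simp add: algebra_simps)
      then show ?thesis
        using q_log_concave[of r A "upd x i y" "upd ((1 - \<sigma>) *\<^sub>R x + \<sigma> *\<^sub>R x') i z"] that
        unfolding upd_mix by (simp add: Q_def)
    qed
    show "N0 = (LINT y:{0..}|lborel. Q 0 y)" unfolding Q01 N0_def qI ..
    show "0 < N0" using insert.prems(1) \<delta> by (simp add: N0_def)
    show "(LINT y:{0..}|lborel. Q \<theta> y) \<le> N0 * exp (\<theta> * c)" if "\<theta> \<in> {0<..1}" for \<theta>
      unfolding Q_def qI N0_def using insert.prems(2)[OF that] \<delta> by (simp add: mult.assoc)
    show "(\<lambda>y. W A (upd x' i y)) \<in> borel_measurable borel"
      unfolding W_def by (rule wint_upd_measurable[OF i pm pb])
    show "exp (- B) * Q 1 y \<le> W A (upd x' i y)" "W A (upd x' i y) \<le> exp B * Q 1 y" for y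
      unfolding Q01 W_def B_def by (rule wint_bounds[OF pm prod_tilt_bounds])+
    have "countable {y. \<not> isCont (\<lambda>y. W A (upd x' i y)) y}"
      unfolding W_def by (rule wint_upd_discontinuities[OF i pm, of "exp B"])
        (use prod_tilt_bounds[where A=A] order_trans[OF exp_ge_zero prod_tilt_bounds(1)[where A=A]] in \<open>auto simp: B_def\<close>)
    then show "countable {y. 0 < y \<and> \<not> isCont (\<lambda>y. W A (upd x' i y)) y}"
      by (rule countable_subset[rotated]) auto
    show "\<psi> \<in> borel_measurable borel" unfolding \<psi>_def using \<Psi>m qm by (rule borel_measurable_divide)
    show "\<bar>\<psi> y\<bar> \<le> B'" for y
    proof (cases "q A (upd x i y) = 0")
      case True
      have "0 \<le> B'" using mb[of 0] by linarith
      then show ?thesis using True by (simp add: \<psi>_def)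
    next
      case False
      then have "0 < q A (upd x i y)" using qpos[of A "upd x i y"] by simp
      then show ?thesis using \<Psi>b[of "upd x i y"] by (simp add: \<psi>_def field_simps)
    qed
    \<comment> \<open>The induction hypothesis at moved centres and with its own slope c', which is
      why x, x' and c vary in the induction.\<close>
    show "W A (upd x' i z) \<le> Q 0 y * exp (\<psi> y + c')"
      if "0 < Q 0 y" "\<And>\<theta>. \<theta> \<in> {0<..1} \<Longrightarrow> Q \<theta> ((1 - \<theta>) * y + \<theta> * z) \<le> Q 0 y * exp (\<theta> * c')" for y z c'
      using insert.IH[of "upd x i y" "upd x' i z" c'] that unfolding upd_mix by (simp add: Q_def \<psi>_def)
  qed
  also have "(LINT y:{0..}|lborel. exp (g i y) * W A (upd x' i y)) = \<delta> * W (insert i A) x'"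
  proof -
    have "\<bar>exp (g i y)\<bar> \<le> exp \<bar>s i\<bar>" for y using g_bound[of i y] by simp
    then have "(LINT y:{0..}|lborel. exp (g i y) * W A (upd x' i y))
        = \<delta> * wint (insert i A) (\<lambda>z. ?p z * tilt i (z $ i)) x'"
      unfolding W_def tilt_def
      by (intro wint_half_slice(2)[OF i pm[unfolded tilt_def] _ pb[unfolded tilt_def] _ pe[unfolded tilt_def]])
        (auto simp: g_even)
    then show ?thesis using i by (simp add: W_def mult.commute)
  qed
  also have "(LINT y:{0..}|lborel. (\<psi> y + g i y) * Q 0 y)
      = \<delta> * (\<Psi> (insert i A) x - C * (s i)\<^sup>2 / 4 * q (insert i A) x)"
  proof -
    have p1: "\<psi> y * Q 0 y = \<Psi> A (upd x i y)" for y
      using \<Psi>b[of "upd x i y"] by (auto simp: \<psi>_def Q01)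
    have S1: "set_integrable lborel {0..} (\<lambda>y. \<Psi> A (upd x i y))"
        "(LINT y:{0..}|lborel. \<Psi> A (upd x i y)) = \<delta> * wint (insert i A) ?m x"
    proof -
      have "set_integrable lborel {0..} (\<lambda>y. 1 * wint A ?m (upd x i y))"
        by (rule wint_half_slice(1)[OF i mm _ mb _ me, where c=1]) auto
      then show "set_integrable lborel {0..} (\<lambda>y. \<Psi> A (upd x i y))" by (simp add: \<Psi>_def)
      have "(LINT y:{0..}|lborel. 1 * wint A ?m (upd x i y))
          = \<delta> * wint (insert i A) (\<lambda>z. ?m z * window_average \<delta> (\<lambda>_. 1) (z $ i)) x"
        by (rule wint_half_slice(2)[OF i mm _ mb _ me, where c=1]) auto
      then show "(LINT y:{0..}|lborel. \<Psi> A (upd x i y)) = \<delta> * wint (insert i A) ?m x"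
        by (simp add: one \<Psi>_def)
    qed
    have S2: "set_integrable lborel {0..} (\<lambda>y. g i y * q A (upd x i y))"
        "(LINT y:{0..}|lborel. g i y * q A (upd x i y)) = \<delta> * wint (insert i A) (\<lambda>z. mean i (z $ i)) x"
    proof -
      show "set_integrable lborel {0..} (\<lambda>y. g i y * q A (upd x i y))"
        by (rule wint_half_slice(1)[OF i _ g_measurable _ g_bound, where b=1]) (auto simp: g_even)
      have "(LINT y:{0..}|lborel. g i y * q A (upd x i y))
          = \<delta> * wint (insert i A) (\<lambda>z. 1 * window_average \<delta> (g i) (z $ i)) x"
        by (rule wint_half_slice(2)[OF i _ g_measurable _ g_bound, where b=1]) (auto simp: g_even)
      then show "(LINT y:{0..}|lborel. g i y * q A (upd x i y)) = \<delta> * wint (insert i A) (\<lambda>z. mean i (z $ i)) x"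
        by (simp add: mean_def)
    qed
    have "(LINT y:{0..}|lborel. (\<psi> y + g i y) * Q 0 y)
        = (LINT y:{0..}|lborel. \<Psi> A (upd x i y) + g i y * q A (upd x i y))"
      using p1 by (simp add: distrib_right Q01)
    also have "\<dots> = \<delta> * (wint (insert i A) ?m x + wint (insert i A) (\<lambda>z. mean i (z $ i)) x)"
      by (subst set_integral_add(2)[OF S1(1) S2(1)]) (simp add: S1(2) S2(2) distrib_left)
    also have "wint (insert i A) ?m x + wint (insert i A) (\<lambda>z. mean i (z $ i)) x
        = \<Psi> (insert i A) x - C * (s i)\<^sup>2 / 4 * q (insert i A) x"
    proof -
      have I1: "integrable \<nu> (\<lambda>z. indicator (window \<delta> (insert i A) x) z * ?m z)"
        by (rule wint_integrable[OF mm mb])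
      have I2: "integrable \<nu> (\<lambda>z. indicator (window \<delta> (insert i A) x) z * mean i (z $ i))"
        by (rule wint_integrable[of _ "\<bar>s i\<bar>"]) (use mean_bounds in auto)
      have I3: "integrable \<nu> (\<lambda>z. indicator (window \<delta> (insert i A) x) z * (1 :: real))"
        by (rule wint_integrable[of _ 1]) auto
      have "\<Psi> (insert i A) x = (LINT z|\<nu>. indicator (window \<delta> (insert i A) x) z * ?m z
          + indicator (window \<delta> (insert i A) x) z * mean i (z $ i)
          + C * (s i)\<^sup>2 / 4 * (indicator (window \<delta> (insert i A) x) z * 1))"
        unfolding \<Psi>_def wint_def using i insert.hyps(1)
        by (intro Bochner_Integration.integral_cong refl) (simp add: algebra_simps)
      also have "\<dots> = wint (insert i A) ?m x + wint (insert i A) (\<lambda>z. mean i (z $ i)) x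
        + C * (s i)\<^sup>2 / 4 * q (insert i A) x"
        unfolding wint_def
        by (simp only: Bochner_Integration.integral_add[OF Bochner_Integration.integrable_add[OF I1 I2] integrable_mult_right[OF I3]]
            Bochner_Integration.integral_add[OF I1 I2] integral_mult_right_zero)
      finally show ?thesis by simp
    qed
    finally show ?thesis .
  qed
  \<comment> \<open>The share C s_i^2/4 supplied by the one-dimensional step completes the \<Psi> of
    the larger set.\<close>
  also have "\<delta> * (\<Psi> (insert i A) x - C * (s i)\<^sup>2 / 4 * q (insert i A) x) / N0 + C * (s i)\<^sup>2 / 4 + c
      = \<Psi> (insert i A) x / q (insert i A) x + c"
    using insert.prems(1) \<delta> by (simp add: N0_def diff_divide_distrib)
  finally show ?case using \<delta> by (simp add: N0_def mult.assoc)
qed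

text \<open>With all coordinates free the window is the whole space and \<open>q UNIV\<close> is 1,
  so the comparison applies with slope 0. Each \<open>g i\<close> has Lipschitz constant
  \<bar>s_i\<bar> a_i; undoing the averages costs \<delta> times their sum once in
  \<open>tilt\<close> and once in \<open>mean\<close>, hence the factor 2.\<close>

lemma exp_moment_bound:
  "(LINT z|\<nu>. exp (\<Sum>i\<in>UNIV. g i (z $ i)))
    \<le> exp ((LINT z|\<nu>. (\<Sum>i\<in>UNIV. g i (z $ i))) + (\<Sum>i\<in>UNIV. C * (s i)\<^sup>2 / 4) + 2 * \<delta> * (\<Sum>i\<in>UNIV. \<bar>s i\<bar> * a i))"
proof -
  have lip: "\<bar>g i y - g i z\<bar> \<le> \<bar>s i\<bar> * a i * \<delta>" if "\<bar>y - z\<bar> \<le> \<delta>" for i y z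
  proof -
    have e: "exp (- v) - exp (- u) \<le> u - v" if "0 \<le> v" "v \<le> u" for u v :: real
    proof -
      have "exp (- v) - exp (- u) = exp (- v) * (1 - exp (- (u - v)))"
        by (simp add: right_diff_distrib exp_add[symmetric])
      also have "\<dots> \<le> 1 * (u - v)"
        using that exp_ge_add_one_self[of "- (u - v)"] by (intro mult_mono) (auto simp del: exp_ge_add_one_self)
      finally show ?thesis by simp
    qed
    have e2: "\<bar>exp (- a i * v) - exp (- a i * u)\<bar> \<le> a i * \<bar>u - v\<bar>" if "0 \<le> v" "0 \<le> u" for u v
    proof (cases "v \<le> u")
      case True
      then have "a i * v \<le> a i * u" using a[of i] by (intro mult_left_mono) auto
      then show ?thesis using e[of "a i * v" "a i * u"] that True a[of i] by (simp add: right_diff_distrib)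
    next
      case False
      then have "a i * u \<le> a i * v" using a[of i] by (intro mult_left_mono) auto
      then show ?thesis using e[of "a i * u" "a i * v"] that False a[of i] by (simp add: right_diff_distrib)
    qed
    have "\<bar>g i y - g i z\<bar> = \<bar>s i\<bar> * \<bar>exp (- a i * \<bar>z\<bar>) - exp (- a i * \<bar>y\<bar>)\<bar>"
      unfolding g_def abs_mult[symmetric] by (simp add: right_diff_distrib)
    also have "\<dots> \<le> \<bar>s i\<bar> * (a i * \<delta>)"
    proof (rule mult_left_mono)
      have "\<bar>\<bar>y\<bar> - \<bar>z\<bar>\<bar> \<le> \<delta>" using that by linarith
      then have "a i * \<bar>\<bar>y\<bar> - \<bar>z\<bar>\<bar> \<le> a i * \<delta>" using a[of i] by (intro mult_left_mono) auto
      then show "\<bar>exp (- a i * \<bar>z\<bar>) - exp (- a i * \<bar>y\<bar>)\<bar> \<le> a i * \<delta>"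
        using e2[of "\<bar>z\<bar>" "\<bar>y\<bar>"] by simp
    qed simp
    finally show ?thesis by (simp add: mult.assoc)
  qed
  define \<epsilon> where "\<epsilon> = \<delta> * (\<Sum>i\<in>UNIV. \<bar>s i\<bar> * a i)"
  have \<epsilon>: "\<epsilon> = (\<Sum>i\<in>UNIV. \<bar>s i\<bar> * a i * \<delta>)" by (simp add: \<epsilon>_def sum_distrib_left mult_ac)
  have near: "y \<in> {z - \<delta>..z + \<delta>} \<Longrightarrow> \<bar>y - z\<bar> \<le> \<delta>" for y z by auto
  have mean_le: "mean i z \<le> g i z + \<bar>s i\<bar> * a i * \<delta>" for i z
    unfolding mean_def
  proof (rule window_average_bounds(2)[OF \<delta> g_measurable])
    show "- \<bar>s i\<bar> \<le> g i y" for y using g_bound[of i y] by linarith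
    show "g i y \<le> g i z + \<bar>s i\<bar> * a i * \<delta>" if "y \<in> {z - \<delta>..z + \<delta>}" for y
      using lip[OF near[OF that], of i] by linarith
  qed
  have tilt_ge: "exp (g i z - \<bar>s i\<bar> * a i * \<delta>) \<le> tilt i z" for i z
    unfolding tilt_def
  proof (rule window_average_bounds(1)[OF \<delta>])
    show "exp (g i y) \<le> exp \<bar>s i\<bar>" for y using g_bound[of i y] by simp
    show "exp (g i z - \<bar>s i\<bar> * a i * \<delta>) \<le> exp (g i y)" if "y \<in> {z - \<delta>..z + \<delta>}" for y
      using lip[OF near[OF that], of i] by simp
  qed measurable
  have [simp]: "window \<delta> UNIV x = UNIV" for x by (simp add: window_def)
  have q1: "q UNIV x = 1" for x by (simp add: wint_def prob_space)
  have Sb: "\<bar>\<Sum>i\<in>UNIV. g i (z $ i)\<bar> \<le> (\<Sum>i\<in>UNIV. \<bar>s i\<bar>)" for z :: "real^'n"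
    by (intro order_trans[OF sum_abs] sum_mono g_bound)
  have int1: "integrable \<nu> (\<lambda>z. exp (\<Sum>i\<in>UNIV. g i (z $ i)))"
    using Sb by (intro integrable_const_bound[where B="exp (\<Sum>i\<in>UNIV. \<bar>s i\<bar>)"]) (auto simp: abs_le_iff)
  have int2: "integrable \<nu> (\<lambda>z. \<Sum>i\<in>UNIV. g i (z $ i))"
    using Sb by (intro integrable_const_bound[where B="\<Sum>i\<in>UNIV. \<bar>s i\<bar>"]) auto
  have int3: "integrable \<nu> (\<lambda>z. \<Prod>i\<in>UNIV. tilt i (z $ i))"
    using prod_tilt_bounds[where A=UNIV] order_trans[OF exp_ge_zero prod_tilt_bounds(1)[where A=UNIV]]
    by (intro integrable_const_bound[where B="exp (\<Sum>i\<in>UNIV. \<bar>s i\<bar>)"]) (auto simp: abs_of_nonneg)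
  have int4: "integrable \<nu> (\<lambda>z. \<Sum>j\<in>UNIV. mean j (z $ j) + C * (s j)\<^sup>2 / 4)"
    using sum_mean_bound[where A=UNIV] by (intro integrable_const_bound) auto
  have "exp (- \<epsilon>) * (LINT z|\<nu>. exp (\<Sum>i\<in>UNIV. g i (z $ i))) = (LINT z|\<nu>. exp (- \<epsilon>) * exp (\<Sum>i\<in>UNIV. g i (z $ i)))"
    by simp
  also have "\<dots> \<le> (LINT z|\<nu>. (\<Prod>i\<in>UNIV. tilt i (z $ i)))"
  proof (intro integral_mono integrable_mult_right int1 int3)
    fix z
    have "exp (- \<epsilon>) * exp (\<Sum>i\<in>UNIV. g i (z $ i)) = exp (\<Sum>i\<in>UNIV. g i (z $ i) - \<bar>s i\<bar> * a i * \<delta>)"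
      unfolding exp_add[symmetric] \<epsilon> by (simp add: sum_subtractf)
    also have "\<dots> = (\<Prod>i\<in>UNIV. exp (g i (z $ i) - \<bar>s i\<bar> * a i * \<delta>))" by (rule exp_sum) simp
    also have "\<dots> \<le> (\<Prod>i\<in>UNIV. tilt i (z $ i))" by (intro prod_mono conjI tilt_ge) simp
    finally show "exp (- \<epsilon>) * exp (\<Sum>i\<in>UNIV. g i (z $ i)) \<le> (\<Prod>i\<in>UNIV. tilt i (z $ i))" .
  qed
  also have "\<dots> = W UNIV 0" by (simp add: W_def wint_def)
  also have "\<dots> \<le> exp (\<Psi> UNIV 0)"
    using window_comparison[of UNIV 0 0 0] by (simp add: q1)
  also have "\<Psi> UNIV 0 \<le> (LINT z|\<nu>. (\<Sum>i\<in>UNIV. g i (z $ i)) + (\<epsilon> + (\<Sum>i\<in>UNIV. C * (s i)\<^sup>2 / 4)))"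
  proof -
    have "\<Psi> UNIV 0 = (LINT z|\<nu>. (\<Sum>j\<in>UNIV. mean j (z $ j) + C * (s j)\<^sup>2 / 4))" by (simp add: \<Psi>_def wint_def)
    also have "\<dots> \<le> (LINT z|\<nu>. (\<Sum>i\<in>UNIV. g i (z $ i)) + (\<epsilon> + (\<Sum>i\<in>UNIV. C * (s i)\<^sup>2 / 4)))"
    proof (intro integral_mono int4 Bochner_Integration.integrable_add int2 integrable_const)
      fix z
      show "(\<Sum>j\<in>UNIV. mean j (z $ j) + C * (s j)\<^sup>2 / 4)
          \<le> (\<Sum>i\<in>UNIV. g i (z $ i)) + (\<epsilon> + (\<Sum>i\<in>UNIV. C * (s i)\<^sup>2 / 4))"
        unfolding \<epsilon> sum.distrib[symmetric] using mean_le by (intro sum_mono) (simp add: add.assoc[symmetric])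
    qed
    finally show ?thesis .
  qed
  also have "\<dots> = (LINT z|\<nu>. (\<Sum>i\<in>UNIV. g i (z $ i))) + (\<epsilon> + (\<Sum>i\<in>UNIV. C * (s i)\<^sup>2 / 4))"
    using int2 by (simp add: prob_space)
  finally have "exp (- \<epsilon>) * (LINT z|\<nu>. exp (\<Sum>i\<in>UNIV. g i (z $ i)))
      \<le> exp ((LINT z|\<nu>. (\<Sum>i\<in>UNIV. g i (z $ i))) + (\<epsilon> + (\<Sum>i\<in>UNIV. C * (s i)\<^sup>2 / 4)))" by simp
  then have "exp \<epsilon> * (exp (- \<epsilon>) * (LINT z|\<nu>. exp (\<Sum>i\<in>UNIV. g i (z $ i))))
      \<le> exp \<epsilon> * exp ((LINT z|\<nu>. (\<Sum>i\<in>UNIV. g i (z $ i))) + (\<epsilon> + (\<Sum>i\<in>UNIV. C * (s i)\<^sup>2 / 4)))"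
    by (intro mult_left_mono) auto
  then show ?thesis
    unfolding mult.assoc[symmetric] exp_add[symmetric] by (simp add: \<epsilon>_def algebra_simps)
qed

end

section \<open>Exponential moments and tails\<close>

lemma norm_vec_squared: "(norm (v :: real ^ 'n))\<^sup>2 = (\<Sum>i\<in>UNIV. (v $ i)\<^sup>2)"
  unfolding power2_norm_eq_inner by (simp add: inner_vec_def power2_eq_square)

text \<open>The window bound holds for every \<delta> while the law of X does not involve \<delta>,
  so its error term is sent to 0 on the logarithmic scale. Boundedness of F gives integrability and
  positivity.\<close>

lemma exp_moment_of_unconditional_log_concave:
  fixes M :: "'a measure" and X :: "'a \<Rightarrow> real ^ 'n" and a v :: "real ^ 'n"
  assumes C: "clipping_constant C" and "prob_space M" and X: "X \<in> borel_measurable M"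
    and unc: "unconditional M X" and lc: "log_concave_measure (distr M borel X)"
    and a: "\<And>i. 0 < a $ i"
    and F_def: "F = (\<lambda>\<omega>. \<Sum>i\<in>UNIV. v $ i * (1 - exp (- (a $ i) * \<bar>X \<omega> $ i\<bar>)))"
  shows "prob_space.expectation M (\<lambda>\<omega>. exp (t * (F \<omega> - prob_space.expectation M F)))
    \<le> exp (C / 4 * t\<^sup>2 * (norm v)\<^sup>2)"
    and "0 < prob_space.expectation M (\<lambda>\<omega>. exp (t * (F \<omega> - prob_space.expectation M F)))"
    and "integrable M (\<lambda>\<omega>. exp (t * (F \<omega> - prob_space.expectation M F)))"
proof -
  interpret prob_space M by fact
  note [measurable] = X
  have [measurable]: "(\<lambda>\<omega>. X \<omega> $ i) \<in> borel_measurable M" for i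
    by (rule measurable_compose[OF X borel_measurable_nth])
  have [measurable]: "F \<in> borel_measurable M" unfolding F_def by measurable
  have Fb: "\<bar>F \<omega>\<bar> \<le> (\<Sum>i\<in>UNIV. \<bar>v $ i\<bar>)" for \<omega>
    unfolding F_def
  proof (intro order_trans[OF sum_abs] sum_mono)
    fix i
    have "exp (- (a $ i) * \<bar>X \<omega> $ i\<bar>) \<le> 1" using a[of i] by simp
    then show "\<bar>v $ i * (1 - exp (- (a $ i) * \<bar>X \<omega> $ i\<bar>))\<bar> \<le> \<bar>v $ i\<bar>"
      unfolding abs_mult by (intro mult_left_le) auto
  qed
  have int: "integrable M (\<lambda>\<omega>. exp (r * (F \<omega> - e)))" for r e
  proof (rule integrable_const_bound[where B="exp (\<bar>r\<bar> * ((\<Sum>i\<in>UNIV. \<bar>v $ i\<bar>) + \<bar>e\<bar>))"])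
    have "r * (F \<omega> - e) \<le> \<bar>r\<bar> * ((\<Sum>i\<in>UNIV. \<bar>v $ i\<bar>) + \<bar>e\<bar>)" for \<omega>
    proof -
      have "r * (F \<omega> - e) \<le> \<bar>r\<bar> * \<bar>F \<omega> - e\<bar>" by (metis abs_ge_self abs_mult)
      also have "\<dots> \<le> \<bar>r\<bar> * ((\<Sum>i\<in>UNIV. \<bar>v $ i\<bar>) + \<bar>e\<bar>)"
        using Fb[of \<omega>] by (intro mult_left_mono) linarith+
      finally show ?thesis .
    qed
    then show "AE \<omega> in M. norm (exp (r * (F \<omega> - e))) \<le> exp (\<bar>r\<bar> * ((\<Sum>i\<in>UNIV. \<bar>v $ i\<bar>) + \<bar>e\<bar>))"
      by simp
  qed measurable
  show "integrable M (\<lambda>\<omega>. exp (t * (F \<omega> - expectation F)))" by (rule int)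
  have Eexp: "expectation (\<lambda>\<omega>. exp (t * F \<omega>))
      \<le> exp (t * expectation F + C / 4 * t\<^sup>2 * (norm v)\<^sup>2 + 2 * \<delta> * (\<Sum>i\<in>UNIV. \<bar>t * v $ i\<bar> * a $ i))"
    if \<delta>: "0 < \<delta>" for \<delta>
  proof -
    let ?\<nu> = "distr M borel X"
    interpret N: prob_space ?\<nu> by (rule prob_space_distr[OF X])
    interpret T: tilted_windows ?\<nu> \<delta> C "\<lambda>i. a $ i" "\<lambda>i. t * v $ i"
    proof
      show "distr ?\<nu> borel (flip i) = ?\<nu>" for i
      proof -
        \<comment> \<open>A single reflection is the choice of signs with - 1 at i only.\<close>
        have "flip i \<circ> X = (\<lambda>\<omega>. \<chi> j. (if j = i then -1 else 1) * X \<omega> $ j)"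
          by (simp add: fun_eq_iff vec_eq_iff flip_def)
        then have "distr ?\<nu> borel (flip i) = distr M borel (\<lambda>\<omega>. \<chi> j. (if j = i then -1 else 1) * X \<omega> $ j)"
          by (subst distr_distr) auto
        also have "\<dots> = ?\<nu>" using unc unfolding unconditional_def by simp
        finally show ?thesis .
      qed
    qed (simp_all add: C a \<delta> lc)
    have eq: "(\<Sum>i\<in>UNIV. T.g i (X \<omega> $ i)) = t * F \<omega>" for \<omega>
      by (simp add: T.g_def F_def sum_distrib_left mult.assoc)
    have m: "(\<lambda>z. \<Sum>i\<in>UNIV. T.g i (z $ i)) \<in> borel_measurable borel" by measurable
    have "(LINT z|?\<nu>. exp (\<Sum>i\<in>UNIV. T.g i (z $ i))) = expectation (\<lambda>\<omega>. exp (t * F \<omega>))"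
      using m by (subst integral_distr[OF X]) (auto simp: eq)
    moreover have "(LINT z|?\<nu>. (\<Sum>i\<in>UNIV. T.g i (z $ i))) = t * expectation F"
      using m by (subst integral_distr[OF X]) (auto simp: eq)
    moreover have "(\<Sum>i\<in>UNIV. C * (t * v $ i)\<^sup>2 / 4) = C / 4 * t\<^sup>2 * (norm v)\<^sup>2"
      unfolding norm_vec_squared by (simp add: sum_distrib_left power_mult_distrib mult_ac)
    ultimately show ?thesis using T.exp_moment_bound by (simp only:)
  qed
  define E where "E = expectation (\<lambda>\<omega>. exp (t * F \<omega>))"
  have int0: "integrable M (\<lambda>\<omega>. exp (t * F \<omega>))" using int[of t 0] by simp
  have Epos: "0 < E"
  proof -
    have "exp (- \<bar>t\<bar> * (\<Sum>i\<in>UNIV. \<bar>v $ i\<bar>)) = expectation (\<lambda>\<omega>. exp (- \<bar>t\<bar> * (\<Sum>i\<in>UNIV. \<bar>v $ i\<bar>)))"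
      by (simp add: prob_space)
    also have "\<dots> \<le> E"
      unfolding E_def
    proof (intro integral_mono int0)
      fix \<omega>
      have "\<bar>t * F \<omega>\<bar> \<le> \<bar>t\<bar> * (\<Sum>i\<in>UNIV. \<bar>v $ i\<bar>)"
        unfolding abs_mult using Fb by (intro mult_left_mono) auto
      then show "exp (- \<bar>t\<bar> * (\<Sum>i\<in>UNIV. \<bar>v $ i\<bar>)) \<le> exp (t * F \<omega>)" by simp
    qed simp
    finally show ?thesis by (rule less_le_trans[OF exp_gt_zero])
  qed
  define L where "L = (\<Sum>i\<in>UNIV. \<bar>t * v $ i\<bar> * a $ i)"
  have L0: "0 \<le> L" unfolding L_def using a by (intro sum_nonneg) (simp add: less_imp_le)
  have "ln E \<le> t * expectation F + C / 4 * t\<^sup>2 * (norm v)\<^sup>2"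
  proof (rule field_le_epsilon)
    fix e :: real assume e: "0 < e"
    \<comment> \<open>The added 1 keeps the denominator positive when \<open>L\<close> is 0.\<close>
    let ?\<delta> = "e / (2 * L + 1)"
    have d: "0 < ?\<delta>" "2 * ?\<delta> * L \<le> e" using e L0 by (auto simp: field_simps)
    have "E \<le> exp (t * expectation F + C / 4 * t\<^sup>2 * (norm v)\<^sup>2 + 2 * ?\<delta> * L)"
      unfolding E_def L_def by (rule Eexp) (use d(1) in \<open>simp add: L_def\<close>)
    then have "ln E \<le> ln (exp (t * expectation F + C / 4 * t\<^sup>2 * (norm v)\<^sup>2 + 2 * ?\<delta> * L))"
      using Epos by (subst ln_le_cancel_iff) auto
    then have "ln E \<le> t * expectation F + C / 4 * t\<^sup>2 * (norm v)\<^sup>2 + 2 * ?\<delta> * L" by simp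
    then show "ln E \<le> t * expectation F + C / 4 * t\<^sup>2 * (norm v)\<^sup>2 + e" using d(2) by linarith
  qed
  then have "E \<le> exp (t * expectation F + C / 4 * t\<^sup>2 * (norm v)\<^sup>2)"
    using Epos by (metis exp_le_cancel_iff exp_ln)
  then have "exp (- t * expectation F) * E
      \<le> exp (- t * expectation F) * exp (t * expectation F + C / 4 * t\<^sup>2 * (norm v)\<^sup>2)"
    by (intro mult_left_mono) auto
  also have "\<dots> = exp (C / 4 * t\<^sup>2 * (norm v)\<^sup>2)" unfolding exp_add[symmetric] by simp
  moreover have "exp (- t * expectation F) * E = expectation (\<lambda>\<omega>. exp (t * (F \<omega> - expectation F)))"
    unfolding E_def integral_mult_right_zero[symmetric]
    by (intro Bochner_Integration.integral_cong refl) (simp add: exp_add[symmetric] right_diff_distrib)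
  ultimately show "expectation (\<lambda>\<omega>. exp (t * (F \<omega> - expectation F))) \<le> exp (C / 4 * t\<^sup>2 * (norm v)\<^sup>2)"
    "0 < expectation (\<lambda>\<omega>. exp (t * (F \<omega> - expectation F)))"
    using Epos by (metis, metis exp_gt_zero mult_pos_pos)
qed

lemma (in prob_space) subgaussian_tail:
  assumes [measurable]: "Y \<in> borel_measurable M" and K: "0 < K" and r: "0 < r"
    and mgf: "\<And>t. integrable M (\<lambda>\<omega>. exp (t * Y \<omega>))" "\<And>t. expectation (\<lambda>\<omega>. exp (t * Y \<omega>)) \<le> exp (K * t\<^sup>2)"
  shows "prob {\<omega> \<in> space M. \<bar>Y \<omega>\<bar> \<ge> r} \<le> 2 * exp (- (r\<^sup>2 / (4 * K)))"
proof -
  \<comment> \<open>Minimises K t^2 - t r, with minimum - r^2 / (4 K).\<close>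
  define t where "t = r / (2 * K)"
  have t: "0 < t" using r K by (simp add: t_def)
  have e: "exp (- t * r) * exp (K * t\<^sup>2) = exp (- (r\<^sup>2 / (4 * K)))"
    unfolding exp_add[symmetric] using K by (simp add: t_def power2_eq_square field_simps)
  \<comment> \<open>c = 1 and c = - 1 give the two tails; only c^2 = 1 enters the moment
    bound.\<close>
  have up: "prob {\<omega> \<in> space M. c * Y \<omega> \<ge> r} \<le> exp (- (r\<^sup>2 / (4 * K)))" if c: "c\<^sup>2 = 1" for c
  proof -
    have int: "integrable M (\<lambda>\<omega>. exp (t * (c * Y \<omega>)))" using mgf(1)[of "t * c"] by (simp add: mult.assoc)
    then have "set_integrable M (space M) (\<lambda>\<omega>. exp (t * (c * Y \<omega>)))"
      unfolding set_integrable_def by (rule integrable_mult_indicator[rotated]) simp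
    then have "prob {\<omega> \<in> space M. c * Y \<omega> \<ge> r}
        \<le> exp (- t * r) * (LINT \<omega>:space M|M. exp (t * (c * Y \<omega>)))"
      by (rule Chernoff_ineq_ge[OF t]) simp
    also have "(LINT \<omega>:space M|M. exp (t * (c * Y \<omega>))) = expectation (\<lambda>\<omega>. exp (t * c * Y \<omega>))"
      using set_integral_space[OF int] by (simp add: mult.assoc)
    finally have "prob {\<omega> \<in> space M. c * Y \<omega> \<ge> r} \<le> exp (- t * r) * expectation (\<lambda>\<omega>. exp (t * c * Y \<omega>))" .
    also have "\<dots> \<le> exp (- t * r) * exp (K * t\<^sup>2)"
      using mgf(2)[of "t * c"] c by (intro mult_left_mono) (auto simp: power_mult_distrib)
    finally show ?thesis unfolding e .
  qed
  have "prob {\<omega> \<in> space M. \<bar>Y \<omega>\<bar> \<ge> r} \<le> prob ({\<omega> \<in> space M. 1 * Y \<omega> \<ge> r} \<union> {\<omega> \<in> space M. -1 * Y \<omega> \<ge> r})"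
    by (rule finite_measure_mono) auto
  also have "\<dots> \<le> prob {\<omega> \<in> space M. 1 * Y \<omega> \<ge> r} + prob {\<omega> \<in> space M. -1 * Y \<omega> \<ge> r}"
    by (rule measure_Un_le) auto
  finally show ?thesis using up[of 1] up[of "-1"] by simp
qed

theorem corollary9p2:
  fixes C_clip :: real
    and M :: "'a measure"
    and X :: "'a \<Rightarrow> real ^ 'n"
    and a v :: "real ^ 'n"
  assumes "clipping_constant C_clip"
    and "prob_space M"
    and "X \<in> borel_measurable M"
    and "unconditional M X"
    and "log_concave_measure (distr M borel X)"
    and "\<And>i. a $ i > 0"
  defines "C_T \<equiv> C_clip / 4"
    and "F \<equiv> \<lambda>\<omega>. \<Sum>i\<in>UNIV. v $ i * (1 - exp (- (a $ i) * \<bar>X \<omega> $ i\<bar>))"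
  shows "(\<forall>t :: real.
            ln (prob_space.expectation M
                  (\<lambda>\<omega>. exp (t * (F \<omega> - prob_space.expectation M F))))
              \<le> C_T * t\<^sup>2 * (norm v)\<^sup>2) \<and>
         (\<forall>r>0. v \<noteq> 0 \<longrightarrow>
            prob_space.prob M {\<omega> \<in> space M. \<bar>F \<omega> - prob_space.expectation M F\<bar> \<ge> r}
              \<le> 2 * exp (- (r\<^sup>2 / (4 * C_T * (norm v)\<^sup>2))))"
proof -
  interpret prob_space M by fact
  note mgf = exp_moment_of_unconditional_log_concave[OF assms(1-6) meta_eq_to_obj_eq[OF F_def], folded C_T_def]
  have C0: "0 < C_T" using assms(1) by (simp add: C_T_def clipping_constant_def)
  have "(\<lambda>\<omega>. X \<omega> $ i) \<in> borel_measurable M" for i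
    by (rule measurable_compose[OF assms(3) borel_measurable_nth])
  then have Fm: "F \<in> borel_measurable M" unfolding F_def by measurable
  show ?thesis
  proof (intro conjI allI impI)
    fix t :: real
    have "ln (expectation (\<lambda>\<omega>. exp (t * (F \<omega> - expectation F)))) \<le> ln (exp (C_T * t\<^sup>2 * (norm v)\<^sup>2))"
      using mgf(1,2)[of t] by (subst ln_le_cancel_iff) auto
    then show "ln (expectation (\<lambda>\<omega>. exp (t * (F \<omega> - expectation F)))) \<le> C_T * t\<^sup>2 * (norm v)\<^sup>2" by simp
  next
    fix r :: real assume r: "r > 0" and v: "v \<noteq> 0"
    have "prob {\<omega> \<in> space M. \<bar>F \<omega> - expectation F\<bar> \<ge> r} \<le> 2 * exp (- (r\<^sup>2 / (4 * (C_T * (norm v)\<^sup>2))))"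
    proof (rule subgaussian_tail)
      show "expectation (\<lambda>\<omega>. exp (t * (F \<omega> - expectation F))) \<le> exp (C_T * (norm v)\<^sup>2 * t\<^sup>2)" for t
        using mgf(1)[of t] by (simp add: mult_ac)
    qed (use mgf(3) C0 v r Fm in auto)
    then show "prob {\<omega> \<in> space M. \<bar>F \<omega> - expectation F\<bar> \<ge> r} \<le> 2 * exp (- (r\<^sup>2 / (4 * C_T * (norm v)\<^sup>2)))"
      by (simp add: mult.assoc)
  qed
qed

end
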